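(* For each $n \geq 2$ let $\mathcal{A}_n$ be uniformly distributed on $\mathcal{M}(n,2)$ and let $C_n = C(\mathcal{A}_n) := \sum_{i=1}^n \chi_i(\mathcal{A}_n)$. Then, as $n \to \infty$, $$\dfrac{C_n - \frac{1}{2}\log n}{\sqrt{\frac{1}{2}\log n}} \stackrel{d}{\longrightarrow} N(0,1).$$
   Context: For $n \geq 1$, $\mathcal{M}(n,2)$ is the (finite) set of $n \times n$ matrices $A = (a_{ij})$ with non-negative integer entries all of whose row sums and column sums equal $2$. Each $A \in \mathcal{M}(n,2)$ is identified with the labelled $2$-regular bipartite multigraph $G_A$ on vertices $\{R_1,\ldots,R_n\} \cup \{C_1,\ldots,C_n\}$ having exactly $a_{ij}$ edges between $R_i$ and $C_j$. A $k$-component of $A$ is a pair $(S,T)$ of non-empty subsets of $\{1,\ldots,n\}$ with $|S| = |T| = k$ such that the submatrix $(a_{ij})_{i\in S, j \in T}$ has all row and column sums equal to $2$. A component is irreducible if no other component $(S',T') \neq (S,T)$ satisfies $S' \subseteq S$, $T' \subseteq T$. $\chi_k(A)$ denotes the number of irreducible $k$-components of $A$, equivalently the number of connected components of $G_A$ having exactly $2k$ vertices. *)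

theory Defs
  imports "HOL-Probability.Probability"
begin

text \<open>
  An \<open>n \<times> n\<close> matrix is a function \<open>nat \<Rightarrow> nat \<Rightarrow> nat\<close> with rows and columns indexed by
  \<open>{1..n}\<close>. Entries outside the index square are required to vanish, so that each matrix has
  exactly one representative.
\<close>

definition M2 :: "nat \<Rightarrow> (nat \<Rightarrow> nat \<Rightarrow> nat) set" where
  "M2 n = {A. (\<forall>i\<in>{1..n}. (\<Sum>j\<in>{1..n}. A i j) = 2) \<and>
              (\<forall>j\<in>{1..n}. (\<Sum>i\<in>{1..n}. A i j) = 2) \<and>
              (\<forall>i j. i \<notin> {1..n} \<or> j \<notin> {1..n} \<longrightarrow> A i j = 0)}"

definition k_component :: "nat \<Rightarrow> (nat \<Rightarrow> nat \<Rightarrow> nat) \<Rightarrow> nat \<Rightarrow> nat set \<times> nat set \<Rightarrow> bool" where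
  "k_component n A k = (\<lambda>(S, T).
     S \<noteq> {} \<and> T \<noteq> {} \<and> S \<subseteq> {1..n} \<and> T \<subseteq> {1..n} \<and> card S = k \<and> card T = k \<and>
     (\<forall>i\<in>S. (\<Sum>j\<in>T. A i j) = 2) \<and> (\<forall>j\<in>T. (\<Sum>i\<in>S. A i j) = 2))"

definition component :: "nat \<Rightarrow> (nat \<Rightarrow> nat \<Rightarrow> nat) \<Rightarrow> nat set \<times> nat set \<Rightarrow> bool" where
  "component n A P \<longleftrightarrow> (\<exists>k. k_component n A k P)"

definition irreducible_component :: "nat \<Rightarrow> (nat \<Rightarrow> nat \<Rightarrow> nat) \<Rightarrow> nat set \<times> nat set \<Rightarrow> bool" where
  "irreducible_component n A P \<longleftrightarrow>
     component n A P \<and>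
     \<not> (\<exists>Q. component n A Q \<and> Q \<noteq> P \<and> fst Q \<subseteq> fst P \<and> snd Q \<subseteq> snd P)"

definition chi :: "nat \<Rightarrow> nat \<Rightarrow> (nat \<Rightarrow> nat \<Rightarrow> nat) \<Rightarrow> nat" where
  "chi n k A = card {P. k_component n A k P \<and> irreducible_component n A P}"

definition num_components :: "nat \<Rightarrow> (nat \<Rightarrow> nat \<Rightarrow> nat) \<Rightarrow> nat" where
  "num_components n A = (\<Sum>i=1..n. chi n i A)"

lemma finite_M2: "finite (M2 n)"
proof -
  let ?I = "{1..n}"
  let ?F = "{f. \<forall>p. (p \<in> ?I \<times> ?I \<longrightarrow> f p \<in> {0..2::nat}) \<and> (p \<notin> ?I \<times> ?I \<longrightarrow> f p = 0)}"
  have fin: "finite ?F"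
    by (intro finite_set_of_finite_funs finite_cartesian_product finite_atLeastAtMost)
  have "M2 n \<subseteq> curry ` ?F"
  proof
    fix A assume A: "A \<in> M2 n"
    have le2: "A i j \<in> {0..2}" if i: "i \<in> ?I" and j: "j \<in> ?I" for i j
    proof -
      have "A i j \<le> (\<Sum>j\<in>?I. A i j)"
        by (rule member_le_sum[OF j]) simp_all
      also have "\<dots> = 2"
        using A i unfolding M2_def by blast
      finally show ?thesis by simp
    qed
    have zero: "A i j = 0" if "i \<notin> ?I \<or> j \<notin> ?I" for i j
      using A that unfolding M2_def by blast
    have "case_prod A \<in> ?F"
    proof (intro CollectI allI conjI impI)
      fix p
      assume "p \<in> ?I \<times> ?I"
      then show "case_prod A p \<in> {0..2}"
        using le2[of "fst p" "snd p"] by (simp only: case_prod_beta mem_Times_iff)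
    next
      fix p
      assume "p \<notin> ?I \<times> ?I"
      then show "case_prod A p = 0"
        using zero[of "fst p" "snd p"] by (simp only: case_prod_beta mem_Times_iff de_Morgan_conj)
    qed
    then have "curry (case_prod A) \<in> curry ` ?F"
      by (rule imageI)
    then show "A \<in> curry ` ?F"
      by (simp only: curry_case_prod)
  qed
  then show ?thesis
    by (rule finite_surj[OF fin])
qed

lemma M2_nonempty: "M2 n \<noteq> {}"
proof -
  define A :: "nat \<Rightarrow> nat \<Rightarrow> nat"
    where "A i j = (if i = j then (if i \<in> {1..n} then 2 else 0) else 0)" for i j
  have rows: "\<forall>i\<in>{1..n}. (\<Sum>j\<in>{1..n}. A i j) = 2"
    unfolding A_def by (subst sum.delta') simp_all
  have cols: "\<forall>j\<in>{1..n}. (\<Sum>i\<in>{1..n}. A i j) = 2"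
    unfolding A_def by (subst sum.delta) simp_all
  have zero: "\<forall>i j. i \<notin> {1..n} \<or> j \<notin> {1..n} \<longrightarrow> A i j = 0"
    by (simp add: A_def)
  from rows cols zero have "A \<in> M2 n"
    unfolding M2_def by (intro CollectI conjI)
  then show ?thesis by (metis empty_iff)
qed

lemma prob_space_uniform_M2: "prob_space (uniform_count_measure (M2 n))"
  by (rule prob_space_uniform_count_measure[OF finite_M2 M2_nonempty])

end

theory Submission
  imports Defs
begin

text \<open>
  Put \<open>W n x\<close> for the sum of \<open>x ^ C A\<close> over all matrices \<open>A\<close> of order \<open>n\<close>, where \<open>C A\<close> is the number of
  components. The characteristic function of \<open>C\<close> at \<open>t\<close> is the ratio \<open>W n x / W n 1\<close> at
  \<open>x = exp (\<i> t)\<close>, so by Levy's continuity theorem it is enough to know this ratio for \<open>x\<close> tending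
  to \<open>1\<close>.

  A recurrence for \<open>W\<close> comes from removing one row \<open>r\<close>. If \<open>r\<close> contains an entry \<open>2\<close>, then its row and
  column form a component by themselves, and deleting them removes exactly one component
  (\<open>weight_entry_two\<close>). Otherwise \<open>r\<close> contains two entries \<open>1\<close>, in columns \<open>a\<close> and \<open>b\<close>; deleting \<open>r\<close>
  and adding column \<open>b\<close> to column \<open>a\<close> contracts a path of the bipartite multigraph, which keeps the
  number of components. The original matrix is recovered by deciding which of the rows that meet the merged
  column is the second row of column \<open>a\<close>. There are two choices, except that there is only one when
  the merged column has an entry \<open>2\<close>, and those exceptional matrices are counted by the first case
  (\<open>weight_two_ones\<close>). Altogether
  \<open>W n = n (n - 1 + x) W (n - 1) - x n (n - 1)\<^sup>2 / 2 * W (n - 2)\<close>.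

  After division by \<open>(n!)\<^sup>2\<close> this is the recurrence for the Taylor coefficients of
  \<open>exp (y z) * (1 - z) powr (- y)\<close> with \<open>y = x / 2\<close> (\<open>weight_eq_coeff\<close>). The factor \<open>exp (y z)\<close> is entire, so the
  \<open>n\<close>-th coefficient is asymptotic to \<open>exp y\<close> times the \<open>n\<close>-th coefficient
  \<open>y (y + 1) \<dots> (y + n - 1) / n!\<close> of the binomial series, even when \<open>y\<close> varies with \<open>n\<close> inside a
  convergent sequence (\<open>comp_fps_over_rising_ratio_tendsto\<close>). For \<open>y = 1/2 + d\<close> with \<open>d\<close> tending to
  \<open>0\<close>, the quotient of that product by the same product at \<open>1/2\<close> is the product of the factors
  \<open>1 + d / (m + 1/2)\<close>, which is \<open>exp (d ln n + o(1))\<close> because the shifted harmonic sum is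
  \<open>ln n + O(1)\<close> (\<open>rising_ratio_quotient_tendsto\<close>). Hence \<open>W n x / W n 1\<close> behaves like
  \<open>exp ((x - 1) / 2 * ln n)\<close>, the generating function of a Poisson variable with mean and variance
  \<open>ln n / 2\<close>, and the normal limit follows by a second-order expansion of \<open>exp (\<i> t / s)\<close> with
  \<open>s\<^sup>2 = ln n / 2\<close>.
\<close>

section \<open>Two-regular matrices and their components\<close>

text \<open>
  The index sets are arbitrary, because deleting rows and columns of a matrix on \<open>{1..n}\<close> does not
  lead back to such a matrix without a relabelling.
\<close>

definition reg2 :: "'a set \<Rightarrow> 'b set \<Rightarrow> ('a \<Rightarrow> 'b \<Rightarrow> nat) set" where
  "reg2 S T = {A. (\<forall>i\<in>S. (\<Sum>j\<in>T. A i j) = 2) \<and> (\<forall>j\<in>T. (\<Sum>i\<in>S. A i j) = 2) \<and>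
                  (\<forall>i j. i \<notin> S \<or> j \<notin> T \<longrightarrow> A i j = 0)}"

lemma M2_eq_reg2: "M2 n = reg2 {1..n} {1..n}"
  by (simp add: M2_def reg2_def)

lemma
  assumes "A \<in> reg2 S T"
  shows reg2_row_sum: "i \<in> S \<Longrightarrow> (\<Sum>j\<in>T. A i j) = 2"
    and reg2_col_sum: "j \<in> T \<Longrightarrow> (\<Sum>i\<in>S. A i j) = 2"
    and reg2_outside: "i \<notin> S \<or> j \<notin> T \<Longrightarrow> A i j = 0"
  using assms by (auto simp: reg2_def)

lemma finite_reg2:
  assumes "finite S" "finite T"
  shows "finite (reg2 S T)"
proof (rule finite_subset)
  let ?F = "{f. \<forall>p. (p \<in> S \<times> T \<longrightarrow> f p \<in> {0..2::nat}) \<and> (p \<notin> S \<times> T \<longrightarrow> f p = 0)}"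
  show "finite (curry ` ?F)"
    using assms by (intro finite_imageI finite_set_of_finite_funs) auto
  show "reg2 S T \<subseteq> curry ` ?F"
  proof
    fix A assume A: "A \<in> reg2 S T"
    have "A i j \<le> 2" if "i \<in> S" "j \<in> T" for i j
      using member_le_sum[of j T "A i"] reg2_row_sum[OF A that(1)] that assms by simp
    then have "case_prod A \<in> ?F"
      using reg2_outside[OF A] by auto
    then have "curry (case_prod A) \<in> curry ` ?F" by (rule imageI)
    then show "A \<in> curry ` ?F" by (simp only: curry_case_prod)
  qed
qed

text \<open>
  A component is determined by its columns: its rows are those that meet them. The column
  sets that belong to unions of components are those that no row meets only partly, and the connected
  components are the minimal nonempty ones.
\<close>

definition closed_cols :: "'b set \<Rightarrow> ('a \<Rightarrow> 'b \<Rightarrow> nat) \<Rightarrow> 'b set set" where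
  "closed_cols T A =
     {Q. Q \<subseteq> T \<and> (\<forall>i j k. A i j \<noteq> 0 \<longrightarrow> A i k \<noteq> 0 \<longrightarrow> j \<in> Q \<longrightarrow> k \<in> Q)}"

lemma closed_colsI:
  assumes "Q \<subseteq> T" "\<And>i j k. A i j \<noteq> 0 \<Longrightarrow> A i k \<noteq> 0 \<Longrightarrow> j \<in> Q \<Longrightarrow> k \<in> Q"
  shows "Q \<in> closed_cols T A"
  using assms unfolding closed_cols_def by blast

lemma closed_cols_subset: "Q \<in> closed_cols T A \<Longrightarrow> Q \<subseteq> T"
  unfolding closed_cols_def by blast

lemma closed_colsD:
  "Q \<in> closed_cols T A \<Longrightarrow> A i j \<noteq> 0 \<Longrightarrow> A i k \<noteq> 0 \<Longrightarrow> j \<in> Q \<Longrightarrow> k \<in> Q"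
  unfolding closed_cols_def by blast

definition minimal_members :: "'b set set \<Rightarrow> 'b set set" where
  "minimal_members F = {Q \<in> F. Q \<noteq> {} \<and> (\<forall>Q'\<in>F. Q' \<noteq> {} \<longrightarrow> Q' \<subseteq> Q \<longrightarrow> Q' = Q)}"

definition ncomp :: "'b set \<Rightarrow> ('a \<Rightarrow> 'b \<Rightarrow> nat) \<Rightarrow> nat" where
  "ncomp T A = card (minimal_members (closed_cols T A))"

definition rows_of :: "('a \<Rightarrow> 'b \<Rightarrow> nat) \<Rightarrow> 'b set \<Rightarrow> 'a set" where
  "rows_of A Q = {i. \<exists>j\<in>Q. A i j \<noteq> 0}"

lemma sum_subset_eq_imp_zero:
  fixes f :: "'a \<Rightarrow> nat"
  assumes "finite T" "Q \<subseteq> T" "sum f Q = sum f T" "k \<in> T - Q"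
  shows "f k = 0"
proof -
  have "sum f T = sum f (T - Q) + sum f Q"
    using assms by (intro sum.subset_diff) auto
  then show ?thesis using assms by (simp add: sum_eq_0_iff)
qed

text \<open>
  A row of the submatrix on \<open>(P, Q)\<close> that sums to \<open>2\<close> has used up its whole row sum in \<open>A\<close>, so all its
  entries outside \<open>Q\<close> vanish, and likewise for columns. Conversely, closedness gives the sums, and
  \<open>P\<close> and \<open>Q\<close> have the same size because both count half of the total of the submatrix.
\<close>

lemma component_iff:
  assumes A: "A \<in> M2 n"
  shows "component n A (P, Q) \<longleftrightarrow> Q \<noteq> {} \<and> Q \<in> closed_cols {1..n} A \<and> P = rows_of A Q"
proof -
  let ?I = "{1..n}"
  note A' = A[unfolded M2_eq_reg2]
  show ?thesis
  proof
    assume "component n A (P, Q)"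
    then have PQ: "P \<noteq> {}" "Q \<noteq> {}" "P \<subseteq> ?I" "Q \<subseteq> ?I"
      and rs: "\<And>i. i \<in> P \<Longrightarrow> (\<Sum>j\<in>Q. A i j) = 2" and cs: "\<And>j. j \<in> Q \<Longrightarrow> (\<Sum>i\<in>P. A i j) = 2"
      unfolding component_def k_component_def by auto
    have z1: "j \<in> Q" if "i \<in> P" "A i j \<noteq> 0" for i j
      using sum_subset_eq_imp_zero[of ?I Q "A i" j] rs[of i] reg2_row_sum[OF A', of i]
        reg2_outside[OF A', of i j] PQ that by force
    have z2: "i \<in> P" if "j \<in> Q" "A i j \<noteq> 0" for i j
      using sum_subset_eq_imp_zero[of ?I P "\<lambda>i. A i j" i] cs[of j] reg2_col_sum[OF A', of j]
        reg2_outside[OF A', of i j] PQ that by force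
    have "Q \<in> closed_cols ?I A"
      unfolding closed_cols_def using z1 z2 PQ by blast
    moreover have "P = rows_of A Q"
    proof (intro equalityI subsetI)
      fix i assume "i \<in> P"
      then have "\<exists>j\<in>Q. A i j \<noteq> 0" using rs[of i] by (metis sum.neutral zero_neq_numeral)
      then show "i \<in> rows_of A Q" by (simp add: rows_of_def)
    qed (use z2 in \<open>auto simp: rows_of_def\<close>)
    ultimately show "Q \<noteq> {} \<and> Q \<in> closed_cols ?I A \<and> P = rows_of A Q" using PQ by blast
  next
    assume *: "Q \<noteq> {} \<and> Q \<in> closed_cols ?I A \<and> P = rows_of A Q"
    then have Q: "Q \<noteq> {}" "Q \<subseteq> ?I" and P: "P = rows_of A Q"
      and cl: "\<And>i j k. A i j \<noteq> 0 \<Longrightarrow> A i k \<noteq> 0 \<Longrightarrow> j \<in> Q \<Longrightarrow> k \<in> Q"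
      unfolding closed_cols_def by blast+
    have PI: "P \<subseteq> ?I"
    proof
      fix i assume "i \<in> P"
      then obtain j where "A i j \<noteq> 0" unfolding P rows_of_def by auto
      then show "i \<in> ?I" using reg2_outside[OF A', of i j] by metis
    qed
    have rs: "(\<Sum>j\<in>Q. A i j) = 2" if iP: "i \<in> P" for i
    proof -
      have "(\<Sum>j\<in>Q. A i j) = (\<Sum>j\<in>?I. A i j)"
      proof (intro sum.mono_neutral_left ballI)
        fix j assume j: "j \<in> ?I - Q"
        obtain j' where j': "j' \<in> Q" "A i j' \<noteq> 0" using iP unfolding P rows_of_def by auto
        show "A i j = 0" using cl[OF j'(2) _ j'(1), of j] j by (metis DiffD2)
      qed (use Q in auto)
      then show ?thesis using reg2_row_sum[OF A', of i] PI that by auto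
    qed
    have cs: "(\<Sum>i\<in>P. A i j) = 2" if "j \<in> Q" for j
    proof -
      have "(\<Sum>i\<in>P. A i j) = (\<Sum>i\<in>?I. A i j)"
      proof (intro sum.mono_neutral_left ballI)
        fix i assume "i \<in> ?I - P"
        then show "A i j = 0" using that unfolding P rows_of_def by auto
      qed (use PI in auto)
      then show ?thesis using reg2_col_sum[OF A', of j] Q that by auto
    qed
    have "2 * card P = (\<Sum>i\<in>P. \<Sum>j\<in>Q. A i j)" using rs by simp
    also have "\<dots> = (\<Sum>j\<in>Q. \<Sum>i\<in>P. A i j)" by (rule sum.swap)
    also have "\<dots> = 2 * card Q" using cs by simp
    finally have cc: "card P = card Q" by simp
    have "finite Q" using Q finite_subset by blast
    then have "P \<noteq> {}" using cc Q by auto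
    then show "component n A (P, Q)"
      unfolding component_def k_component_def using Q PI rs cs cc by auto
  qed
qed

lemma irreducible_component_iff:
  assumes A: "A \<in> M2 n"
  shows "irreducible_component n A (P, Q) \<longleftrightarrow>
     Q \<in> minimal_members (closed_cols {1..n} A) \<and> P = rows_of A Q"
proof -
  have mono: "rows_of A Q' \<subseteq> rows_of A Q" if "Q' \<subseteq> Q" for Q'
    using that by (auto simp: rows_of_def)
  show ?thesis
    unfolding irreducible_component_def minimal_members_def split_paired_Ex component_iff[OF A]
      fst_conv snd_conv mem_Collect_eq
    using mono by blast
qed

text \<open>
  The sum over sizes partitions the irreducible components, since the size of a pair is the cardinality
  of its row set and lies between \<open>1\<close> and \<open>n\<close>.
\<close>

lemma num_components_eq_ncomp:
  assumes A: "A \<in> M2 n"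
  shows "num_components n A = ncomp {1..n} A"
proof -
  let ?K = "\<lambda>i. {P. k_component n A i P \<and> irreducible_component n A P}"
  let ?M = "minimal_members (closed_cols {1..n} A)"
  have irr: "{P. irreducible_component n A P} = (\<lambda>Q. (rows_of A Q, Q)) ` ?M"
    using irreducible_component_iff[OF A] by auto
  have finM: "finite ?M"
    by (rule finite_subset[of _ "Pow {1..n}"]) (auto simp: minimal_members_def closed_cols_def)
  have "num_components n A = card (\<Union>i\<in>{1..n}. ?K i)"
    unfolding num_components_def chi_def
  proof (rule card_UN_disjoint[symmetric])
    show "\<forall>i\<in>{1..n}. finite (?K i)"
      using finM irr by (metis (no_types, lifting) Collect_mono finite_imageI finite_subset)
    show "\<forall>i\<in>{1..n}. \<forall>j\<in>{1..n}. i \<noteq> j \<longrightarrow> ?K i \<inter> ?K j = {}"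
      by (auto simp: k_component_def)
  qed simp
  also have "(\<Union>i\<in>{1..n}. ?K i) = {P. irreducible_component n A P}"
  proof -
    have "\<exists>i\<in>{1..n}. k_component n A i P" if irrP: "irreducible_component n A P" for P
    proof -
      obtain i where i: "k_component n A i P"
        using irrP by (auto simp: irreducible_component_def component_def)
      then have P: "fst P \<noteq> {}" "fst P \<subseteq> {1..n}" "card (fst P) = i"
        by (auto simp: k_component_def)
      then have "card (fst P) \<le> n" "card (fst P) > 0"
        using card_mono[of "{1..n}" "fst P"] finite_subset[of "fst P" "{1..n}"]
        by (auto simp: card_gt_0_iff)
      then show ?thesis using i P by auto
    qed
    then show ?thesis by blast
  qed
  also have "card \<dots> = card ?M"
    unfolding irr by (rule card_image) (auto simp: inj_on_def)
  finally show ?thesis by (simp add: ncomp_def)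
qed

lemma card_minimal_members_iso:
  assumes "bij_betw f F G" "\<And>X Y. X \<in> F \<Longrightarrow> Y \<in> F \<Longrightarrow> f X \<subseteq> f Y \<longleftrightarrow> X \<subseteq> Y"
    and "\<And>X. X \<in> F \<Longrightarrow> f X = {} \<longleftrightarrow> X = {}"
  shows "card (minimal_members F) = card (minimal_members G)"
proof (rule bij_betw_same_card)
  have G: "G = f ` F" and inj: "inj_on f F" using assms(1) by (auto simp: bij_betw_def)
  have "minimal_members G = f ` minimal_members F"
  proof -
    have *: "f X \<in> minimal_members G \<longleftrightarrow> X \<in> minimal_members F" if "X \<in> F" for X
      using that assms(2,3) inj unfolding G minimal_members_def
      by (auto simp: inj_on_eq_iff)
    have "minimal_members G \<subseteq> f ` F" unfolding G minimal_members_def by auto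
    moreover have "minimal_members F \<subseteq> F" unfolding minimal_members_def by auto
    ultimately show ?thesis using * by blast
  qed
  then show "bij_betw f (minimal_members F) (minimal_members G)"
    using inj unfolding bij_betw_def
    by (metis (no_types, lifting) inj_on_subset mem_Collect_eq minimal_members_def subsetI)
qed

section \<open>Deleting an entry two\<close>

lemma reg2_entry_two:
  assumes A: "A \<in> reg2 S T" and fin: "finite S" "finite T" and "r \<in> S" "c \<in> T" "A r c = 2"
  shows "i \<noteq> r \<Longrightarrow> A i c = 0" "k \<noteq> c \<Longrightarrow> A r k = 0"
proof -
  show "A r k = 0" if "k \<noteq> c"
    using sum_subset_eq_imp_zero[of T "{c}" "A r" k] reg2_row_sum[OF A, of r]
      reg2_outside[OF A, of r k] assms that by (cases "k \<in> T") auto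
  show "A i c = 0" if "i \<noteq> r"
    using sum_subset_eq_imp_zero[of S "{r}" "\<lambda>i. A i c" i] reg2_col_sum[OF A, of c]
      reg2_outside[OF A, of i c] assms that by (cases "i \<in> S") auto
qed

lemma reg2_delete:
  assumes A: "A \<in> reg2 S T" and fin: "finite S" "finite T" and rc: "r \<in> S" "c \<in> T" "A r c = 2"
  shows "A(r := (\<lambda>_. 0)) \<in> reg2 (S - {r}) (T - {c})"
proof -
  note z = reg2_entry_two[OF A fin rc]
  have "(\<Sum>j\<in>T - {c}. A i j) = 2" if "i \<in> S - {r}" for i
    using reg2_row_sum[OF A, of i] sum.remove[of T c "A i"] z(1)[of i] fin rc that by simp
  moreover have "(\<Sum>i\<in>S - {r}. A i j) = 2" if "j \<in> T - {c}" for j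
    using reg2_col_sum[OF A, of j] sum.remove[of S r "\<lambda>i. A i j"] z(2)[of j] fin rc that by simp
  ultimately show ?thesis
    using reg2_outside[OF A] z(1) unfolding reg2_def by auto
qed

lemma reg2_insert:
  assumes B: "B \<in> reg2 (S - {r}) (T - {c})" and fin: "finite S" "finite T" and rc: "r \<in> S" "c \<in> T"
  shows "B(r := (\<lambda>k. if k = c then 2 else 0)) \<in> reg2 S T" (is "?A \<in> _")
proof -
  have z: "B i c = 0" "B r k = 0" for i k using reg2_outside[OF B] by auto
  have "(\<Sum>j\<in>T. ?A i j) = 2" if "i \<in> S" for i
    using reg2_row_sum[OF B, of i] sum.remove[of T c "?A i"] z(1)[of i] fin rc that
    by (cases "i = r") simp_all
  moreover have "(\<Sum>i\<in>S. ?A i j) = 2" if "j \<in> T" for j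
  proof -
    have "(\<Sum>i\<in>S. ?A i j) = ?A r j + (\<Sum>i\<in>S - {r}. B i j)"
      using sum.remove[of S r "\<lambda>i. ?A i j"] fin rc by simp
    also have "\<dots> = 2" using reg2_col_sum[OF B, of j] z(1) that by (cases "j = c") auto
    finally show ?thesis .
  qed
  ultimately show ?thesis
    using reg2_outside[OF B] rc unfolding reg2_def by auto
qed

text \<open>
  The column \<open>c\<close> is linked to no other column. A closed set of \<open>A\<close> is therefore a closed set of
  the smaller matrix with or without \<open>c\<close>, and \<open>{c}\<close> is the one additional minimal set.
\<close>

lemma ncomp_delete:
  assumes A: "A \<in> reg2 S T" and fin: "finite S" "finite T" and rc: "r \<in> S" "c \<in> T" "A r c = 2"
  shows "ncomp T A = Suc (ncomp (T - {c}) (A(r := (\<lambda>_. 0))))"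
proof -
  let ?B = "A(r := (\<lambda>_. 0))"
  let ?F = "closed_cols T A" and ?G = "closed_cols (T - {c}) ?B"
  note z = reg2_entry_two[OF A fin rc]
  have F: "Q \<in> ?F \<longleftrightarrow> Q \<subseteq> T \<and> Q - {c} \<in> ?G" for Q
  proof
    assume Q: "Q \<in> ?F"
    have "Q - {c} \<in> ?G"
    proof (rule closed_colsI)
      fix i j k assume *: "?B i j \<noteq> 0" "?B i k \<noteq> 0" "j \<in> Q - {c}"
      then have "i \<noteq> r" by auto
      then have "A i j \<noteq> 0" "A i k \<noteq> 0" "k \<noteq> c" using * z(1)[of i] by auto
      then show "k \<in> Q - {c}" using closed_colsD[OF Q, of i j k] * by simp
    qed (use closed_cols_subset[OF Q] in blast)
    then show "Q \<subseteq> T \<and> Q - {c} \<in> ?G" using closed_cols_subset[OF Q] by simp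
  next
    assume Q: "Q \<subseteq> T \<and> Q - {c} \<in> ?G"
    show "Q \<in> ?F"
    proof (rule closed_colsI)
      fix i j k assume *: "A i j \<noteq> 0" "A i k \<noteq> 0" "j \<in> Q"
      show "k \<in> Q"
      proof (cases "i = r")
        case True
        then show ?thesis using * z(2) by metis
      next
        case False
        then have "?B i j \<noteq> 0" "?B i k \<noteq> 0" "j \<in> Q - {c}" using * z(1) by auto
        then show ?thesis using Q closed_colsD[of "Q - {c}" "T - {c}" ?B i j k] by auto
      qed
    qed (use Q in blast)
  qed
  have GF: "?G = {Q \<in> ?F. c \<notin> Q}"
  proof -
    have "c \<notin> Q \<and> Q \<subseteq> T" if "Q \<in> ?G" for Q using closed_cols_subset[OF that] by blast
    then have "Q \<in> ?G \<longleftrightarrow> Q \<in> ?F \<and> c \<notin> Q" for Q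
      using F[of Q] by (metis Diff_empty Diff_insert0)
    then show ?thesis by blast
  qed
  have e: "{} \<in> ?G" by (auto simp: closed_cols_def)
  have cF: "{c} \<in> ?F" using F[of "{c}"] e rc by simp
  have "minimal_members ?F = insert {c} (minimal_members ?G)"
  proof (intro equalityI subsetI)
    fix Q assume Q: "Q \<in> minimal_members ?F"
    show "Q \<in> insert {c} (minimal_members ?G)"
    proof (cases "c \<in> Q")
      case True
      then show ?thesis using Q cF unfolding minimal_members_def by blast
    next
      case False
      then show ?thesis using Q unfolding minimal_members_def GF by blast
    qed
  next
    fix Q assume "Q \<in> insert {c} (minimal_members ?G)"
    then consider "Q = {c}" | "Q \<in> minimal_members ?G" by blast
    then show "Q \<in> minimal_members ?F"
    proof cases
      case 1
      then show ?thesis using cF unfolding minimal_members_def by auto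
    next
      case 2
      then show ?thesis unfolding minimal_members_def GF by blast
    qed
  qed
  moreover have "{c} \<notin> minimal_members ?G" unfolding minimal_members_def GF by blast
  moreover have "finite (minimal_members ?G)"
    by (rule finite_subset[of _ "Pow T"]) (use fin in \<open>auto simp: minimal_members_def closed_cols_def\<close>)
  ultimately show ?thesis by (simp add: ncomp_def)
qed

text \<open>
  The weights are values of the generating polynomial of the number of components. That they depend on
  the two index sets only through their common size is a consequence of the recurrence below.
\<close>

definition weight :: "'a set \<Rightarrow> 'b set \<Rightarrow> 'c::field_char_0 \<Rightarrow> 'c" where
  "weight S T x = (\<Sum>A\<in>reg2 S T. x ^ ncomp T A)"

lemma weight_entry_two:
  fixes x :: "'c::field_char_0"
  assumes fin: "finite S" "finite T" and rc: "r \<in> S" "c \<in> T"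
  shows "(\<Sum>A | A \<in> reg2 S T \<and> A r c = 2. x ^ ncomp T A) = x * weight (S - {r}) (T - {c}) x"
  unfolding weight_def sum_distrib_left
proof (rule sum.reindex_bij_witness[where
    i = "\<lambda>B. B(r := (\<lambda>k. if k = c then 2 else 0))" and j = "\<lambda>A. A(r := (\<lambda>_. 0))"])
  fix A assume "A \<in> {A \<in> reg2 S T. A r c = 2}"
  then have A: "A \<in> reg2 S T" "A r c = 2" by auto
  note z = reg2_entry_two[OF A(1) fin rc A(2)]
  show "(A(r := \<lambda>_. 0))(r := \<lambda>k. if k = c then 2 else 0) = A"
    using z(2) A by (auto simp: fun_eq_iff)
  show "A(r := \<lambda>_. 0) \<in> reg2 (S - {r}) (T - {c})"
    using reg2_delete[OF A(1) fin rc A(2)] .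
  show "x * x ^ ncomp (T - {c}) (A(r := \<lambda>_. 0)) = x ^ ncomp T A"
    by (simp add: ncomp_delete[OF A(1) fin rc A(2)])
next
  fix B assume B: "B \<in> reg2 (S - {r}) (T - {c})"
  show "(B(r := \<lambda>k. if k = c then 2 else 0))(r := \<lambda>_. 0) = B"
    using reg2_outside[OF B] by (auto simp: fun_eq_iff)
  show "B(r := \<lambda>k. if k = c then 2 else 0) \<in> {A \<in> reg2 S T. A r c = 2}"
    using reg2_insert[OF B fin rc] by simp
qed

section \<open>Contracting a row with two entries one\<close>

text \<open>
  When row \<open>r\<close> has its two entries \<open>1\<close> in columns \<open>a\<close> and \<open>b\<close>, it is a vertex of degree two whose
  neighbours are \<open>a\<close> and \<open>b\<close>. Merging is the contraction of that path to the single column \<open>a\<close>. To undo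
  it one has to know the other row \<open>s\<close> of column \<open>a\<close>; the rest of the merged column
  then goes to column \<open>b\<close>.
\<close>

definition merge_cols :: "'a \<Rightarrow> 'b \<Rightarrow> 'b \<Rightarrow> ('a \<Rightarrow> 'b \<Rightarrow> nat) \<Rightarrow> 'a \<Rightarrow> 'b \<Rightarrow> nat" where
  "merge_cols r a b A = (\<lambda>i k. if i = r \<or> k = b then 0 else if k = a then A i a + A i b else A i k)"

definition split_col :: "'a \<Rightarrow> 'b \<Rightarrow> 'b \<Rightarrow> ('a \<Rightarrow> 'b \<Rightarrow> nat) \<times> 'a \<Rightarrow> 'a \<Rightarrow> 'b \<Rightarrow> nat" where
  "split_col r a b = (\<lambda>(B, s) i k.
     if i = r then of_bool (k = a \<or> k = b)
     else if k = a then of_bool (i = s)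
     else if k = b then B i a - of_bool (i = s)
     else B i k)"

lemma sum_remove2:
  fixes f :: "'a \<Rightarrow> nat"
  assumes "finite T" "a \<in> T" "b \<in> T" "a \<noteq> b"
  shows "sum f T = f a + f b + sum f (T - {a, b})"
proof -
  have "sum f T = f a + sum f (T - {a})" using assms by (simp add: sum.remove)
  also have "sum f (T - {a}) = f b + sum f (T - {a} - {b})"
    using assms by (intro sum.remove) auto
  also have "T - {a} - {b} = T - {a, b}" by auto
  finally show ?thesis by simp
qed

lemma split_col_in_reg2:
  assumes B: "B \<in> reg2 (S - {r}) (T - {b})" and fin: "finite S" "finite T"
    and r: "r \<in> S" and ab: "a \<in> T" "b \<in> T" "a \<noteq> b" and s: "s \<in> S - {r}" "B s a \<noteq> 0"
  shows "split_col r a b (B, s) \<in> reg2 S T" (is "?A \<in> _")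
proof -
  have rows: "(\<Sum>j\<in>T. ?A i j) = 2" if "i \<in> S" for i
  proof (cases "i = r")
    case True
    have "(\<Sum>j\<in>T - {a, b}. ?A r j) = 0"
      by (intro sum.neutral) (auto simp: split_col_def)
    then show ?thesis using sum_remove2[of T a b "?A i"] fin ab True by (simp add: split_col_def)
  next
    case False
    have "(\<Sum>j\<in>T. ?A i j) = ?A i a + ?A i b + (\<Sum>j\<in>T - {a, b}. ?A i j)"
      using sum_remove2 fin ab by metis
    also have "?A i a + ?A i b = B i a"
      using False s ab by (auto simp: split_col_def)
    also have "(\<Sum>j\<in>T - {a, b}. ?A i j) = (\<Sum>j\<in>T - {b} - {a}. B i j)"
      using False by (intro sum.cong) (auto simp: split_col_def)
    also have "B i a + \<dots> = (\<Sum>j\<in>T - {b}. B i j)"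
      using fin ab by (intro sum.remove[symmetric]) auto
    also have "\<dots> = 2" using reg2_row_sum[OF B] that False by auto
    finally show ?thesis .
  qed
  have ones: "(\<Sum>i\<in>S - {r}. of_bool (i = s)) = (1::nat)"
    using fin s by simp
  have cols: "(\<Sum>i\<in>S. ?A i k) = 2" if "k \<in> T" for k
  proof -
    have R: "(\<Sum>i\<in>S. ?A i k) = ?A r k + (\<Sum>i\<in>S - {r}. ?A i k)"
      using fin r by (intro sum.remove) auto
    consider "k = a" | "k = b" | "k \<noteq> a" "k \<noteq> b" by blast
    then show ?thesis
    proof cases
      case 1
      have "(\<Sum>i\<in>S - {r}. ?A i a) = (\<Sum>i\<in>S - {r}. of_bool (i = s))"
        by (intro sum.cong) (auto simp: split_col_def)
      then show ?thesis using R ones 1 by (simp add: split_col_def)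
    next
      case 2
      have "(\<Sum>i\<in>S - {r}. ?A i b) + (\<Sum>i\<in>S - {r}. of_bool (i = s)) = (\<Sum>i\<in>S - {r}. B i a)"
        unfolding sum.distrib[symmetric]
        using s ab by (intro sum.cong) (auto simp: split_col_def)
      also have "\<dots> = 2" using reg2_col_sum[OF B, of a] ab by auto
      finally show ?thesis using R ones 2 by (simp add: split_col_def)
    next
      case 3
      have "(\<Sum>i\<in>S - {r}. ?A i k) = (\<Sum>i\<in>S - {r}. B i k)"
        using 3 by (intro sum.cong) (auto simp: split_col_def)
      also have "\<dots> = 2" using reg2_col_sum[OF B, of k] 3 that by auto
      finally show ?thesis using R 3 by (simp add: split_col_def)
    qed
  qed
  have "?A i j = 0" if "i \<notin> S \<or> j \<notin> T" for i j
    using that reg2_outside[OF B, of i j] reg2_outside[OF B, of i a] r ab s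
    by (auto simp: split_col_def)
  then show ?thesis using rows cols unfolding reg2_def by blast
qed

lemma merge_cols_in_reg2:
  assumes A: "A \<in> reg2 S T" and fin: "finite S" "finite T"
    and r: "r \<in> S" and ab: "a \<in> T" "b \<in> T" "a \<noteq> b" "A r a = 1" "A r b = 1"
  shows "merge_cols r a b A \<in> reg2 (S - {r}) (T - {b})" (is "?B \<in> _")
proof -
  have "(\<Sum>k\<in>T - {a, b}. A r k) = 0"
    using sum_remove2[of T a b "A r"] reg2_row_sum[OF A r] fin ab by simp
  then have z: "A r k = 0" if "k \<notin> {a, b}" for k
    using fin that reg2_outside[OF A, of r k] by (cases "k \<in> T") auto
  have rows: "(\<Sum>j\<in>T - {b}. ?B i j) = 2" if "i \<in> S - {r}" for i
  proof -
    have "(\<Sum>j\<in>T - {b}. ?B i j) = ?B i a + (\<Sum>j\<in>T - {b} - {a}. ?B i j)"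
      using fin ab by (intro sum.remove) auto
    also have "(\<Sum>j\<in>T - {b} - {a}. ?B i j) = (\<Sum>j\<in>T - {a, b}. A i j)"
      using that by (intro sum.cong) (auto simp: merge_cols_def)
    also have "?B i a = A i a + A i b" using that ab by (simp add: merge_cols_def)
    also have "A i a + A i b + (\<Sum>j\<in>T - {a, b}. A i j) = (\<Sum>j\<in>T. A i j)"
      using sum_remove2[of T a b "A i"] fin ab by simp
    also have "\<dots> = 2" using reg2_row_sum[OF A] that by auto
    finally show ?thesis .
  qed
  have R: "(\<Sum>i\<in>S - {r}. A i k) + A r k = 2" if "k \<in> T" for k
    using sum.remove[of S r "\<lambda>i. A i k"] reg2_col_sum[OF A that] fin r by simp
  have cols: "(\<Sum>i\<in>S - {r}. ?B i k) = 2" if "k \<in> T - {b}" for k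
  proof (cases "k = a")
    case True
    have "(\<Sum>i\<in>S - {r}. ?B i a) = (\<Sum>i\<in>S - {r}. A i a) + (\<Sum>i\<in>S - {r}. A i b)"
      unfolding sum.distrib[symmetric] using ab by (intro sum.cong) (auto simp: merge_cols_def)
    then show ?thesis using R[of a] R[of b] ab True by simp
  next
    case False
    have "(\<Sum>i\<in>S - {r}. ?B i k) = (\<Sum>i\<in>S - {r}. A i k)"
      using False that by (intro sum.cong) (auto simp: merge_cols_def)
    then show ?thesis using R[of k] z[of k] False that by simp
  qed
  have "?B i j = 0" if "i \<notin> S - {r} \<or> j \<notin> T - {b}" for i j
    using that reg2_outside[OF A] ab by (auto simp: merge_cols_def)
  then show ?thesis using rows cols unfolding reg2_def by blast
qed

text \<open>
  Columns \<open>a\<close> and \<open>b\<close> are linked through \<open>r\<close>, so a closed set contains both or neither. Dropping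
  \<open>b\<close> is then an order isomorphism onto the closed sets of the merged matrix.
\<close>

lemma ncomp_split_col:
  assumes B: "B \<in> reg2 (S - {r}) (T - {b})"
    and r: "r \<in> S" and ab: "a \<in> T" "b \<in> T" "a \<noteq> b" and s: "s \<in> S - {r}" "B s a \<noteq> 0"
  shows "ncomp T (split_col r a b (B, s)) = ncomp (T - {b}) B"
proof -
  let ?A = "split_col r a b (B, s)"
  let ?F = "closed_cols T ?A" and ?G = "closed_cols (T - {b}) B"
  \<comment> \<open>The map \<open>c\<close> sends each column to its image under the contraction.\<close>
  define c where "c k = (if k = b then a else k)" for k
  have Bz: "B r k = 0" "B i b = 0" for i k using reg2_outside[OF B] by auto
  have Bc: "B i (c k) \<noteq> 0" if "?A i k \<noteq> 0" "i \<noteq> r" for i k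
    using that s by (auto simp: split_col_def c_def split: if_splits)
  have Ar: "c k = a" if "?A r k \<noteq> 0" for k
    using that by (auto simp: split_col_def c_def split: if_splits)
  have lift: "\<exists>k'. c k' = k \<and> ?A i k' \<noteq> 0" if "B i k \<noteq> 0" for i k
  proof (cases "k = a")
    case True
    have "i \<noteq> r" using that Bz(1) by metis
    then have "?A i a \<noteq> 0 \<or> ?A i b \<noteq> 0"
      using that True ab by (cases "i = s") (auto simp: split_col_def)
    then show ?thesis using True ab by (auto simp: c_def)
  next
    case False
    then have "k \<noteq> b" "i \<noteq> r" using that Bz by metis+
    then show ?thesis using False that by (intro exI[of _ k]) (auto simp: c_def split_col_def)
  qed
  have F: "Q \<in> ?F \<longleftrightarrow> Q \<subseteq> T \<and> (b \<in> Q \<longleftrightarrow> a \<in> Q) \<and> Q - {b} \<in> ?G" for Q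
  proof
    assume Q: "Q \<in> ?F"
    have "?A r a \<noteq> 0" "?A r b \<noteq> 0" by (auto simp: split_col_def)
    then have iff: "b \<in> Q \<longleftrightarrow> a \<in> Q" using closed_colsD[OF Q, of r] by blast
    then have cQ: "c k \<in> Q \<longleftrightarrow> k \<in> Q" for k by (simp add: c_def)
    have "Q - {b} \<in> ?G"
    proof (rule closed_colsI)
      fix i j k assume *: "B i j \<noteq> 0" "B i k \<noteq> 0" "j \<in> Q - {b}"
      obtain j' where j': "c j' = j" "?A i j' \<noteq> 0" using lift[OF *(1)] by blast
      obtain k' where k': "c k' = k" "?A i k' \<noteq> 0" using lift[OF *(2)] by blast
      have "j' \<in> Q" using cQ[of j'] j'(1) *(3) by simp
      then have "k' \<in> Q" by (rule closed_colsD[OF Q j'(2) k'(2)])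
      then have "k \<in> Q" using cQ[of k'] k'(1) by simp
      moreover have "k \<noteq> b" using *(2) Bz(2)[of i] by auto
      ultimately show "k \<in> Q - {b}" by simp
    qed (use closed_cols_subset[OF Q] in blast)
    then show "Q \<subseteq> T \<and> (b \<in> Q \<longleftrightarrow> a \<in> Q) \<and> Q - {b} \<in> ?G"
      using closed_cols_subset[OF Q] iff by simp
  next
    assume Q: "Q \<subseteq> T \<and> (b \<in> Q \<longleftrightarrow> a \<in> Q) \<and> Q - {b} \<in> ?G"
    then have cQ: "c k \<in> Q - {b} \<longleftrightarrow> k \<in> Q" for k using ab by (simp add: c_def)
    show "Q \<in> ?F"
    proof (rule closed_colsI)
      fix i j k assume *: "?A i j \<noteq> 0" "?A i k \<noteq> 0" "j \<in> Q"
      show "k \<in> Q"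
      proof (cases "i = r")
        case True
        then have "c j = a" "c k = a" using Ar * by simp_all
        then show ?thesis using cQ[of j] cQ[of k] *(3) by simp
      next
        case False
        have "c j \<in> Q - {b}" using cQ[of j] *(3) by simp
        then have "c k \<in> Q - {b}"
          using closed_colsD[of "Q - {b}" "T - {b}" B i "c j" "c k"] Q Bc[OF *(1) False]
            Bc[OF *(2) False] by simp
        then show ?thesis using cQ[of k] by simp
      qed
    qed (use Q in simp)
  qed
  have Gs: "Q \<subseteq> T \<and> b \<notin> Q" if "Q \<in> ?G" for Q using closed_cols_subset[OF that] by blast
  have "card (minimal_members ?F) = card (minimal_members ?G)"
  proof (rule card_minimal_members_iso[where f = "\<lambda>Q. Q - {b}"])
    show "bij_betw (\<lambda>Q. Q - {b}) ?F ?G"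
    proof (rule bij_betwI[where g = "\<lambda>Q. if a \<in> Q then insert b Q else Q"])
      show "(\<lambda>Q. Q - {b}) \<in> ?F \<rightarrow> ?G" using F by simp
      show "(\<lambda>Q. if a \<in> Q then insert b Q else Q) \<in> ?G \<rightarrow> ?F"
      proof
        fix Q assume Q: "Q \<in> ?G"
        then have "insert b Q - {b} = Q" "Q - {b} = Q" "Q \<subseteq> T" "b \<notin> Q" using Gs[OF Q] by auto
        then show "(if a \<in> Q then insert b Q else Q) \<in> ?F"
          using F[of "if a \<in> Q then insert b Q else Q"] Q ab by simp
      qed
      show "(if a \<in> Q - {b} then insert b (Q - {b}) else Q - {b}) = Q" if "Q \<in> ?F" for Q
        using that[unfolded F] ab by auto
      show "(if a \<in> Q then insert b Q else Q) - {b} = Q" if "Q \<in> ?G" for Q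
        using Gs[OF that] by auto
    qed
    show "X - {b} \<subseteq> Y - {b} \<longleftrightarrow> X \<subseteq> Y" if "X \<in> ?F" "Y \<in> ?F" for X Y
    proof -
      have "b \<in> X \<longleftrightarrow> a \<in> X" "b \<in> Y \<longleftrightarrow> a \<in> Y" using that F by simp_all
      then show ?thesis using ab(3) by blast
    qed
    show "X - {b} = {} \<longleftrightarrow> X = {}" if "X \<in> ?F" for X
    proof -
      have "b \<in> X \<longleftrightarrow> a \<in> X" using that F by simp
      then show ?thesis using ab(3) by blast
    qed
  qed
  then show ?thesis by (simp add: ncomp_def)
qed

text \<open>
  Column \<open>a\<close> has an entry \<open>1\<close> in row \<open>r\<close>, hence exactly one further entry \<open>1\<close>, and
  the row of that entry is the choice \<open>s\<close> that the inverse of the contraction needs.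
\<close>

lemma bij_split_col:
  assumes fin: "finite S" "finite T" and r: "r \<in> S" and ab: "a \<in> T" "b \<in> T" "a \<noteq> b"
  shows "bij_betw (split_col r a b)
           (SIGMA B:reg2 (S - {r}) (T - {b}). {s \<in> S - {r}. B s a \<noteq> 0})
           {A \<in> reg2 S T. A r a = 1 \<and> A r b = 1}" (is "bij_betw _ ?D ?E")
proof (rule bij_betw_imageI)
  let ?f = "split_col r a b"
  have merge: "merge_cols r a b (?f (B, s)) = B" if B: "B \<in> reg2 (S - {r}) (T - {b})"
    and s: "s \<in> S - {r}" "B s a \<noteq> 0" for B s
    using reg2_outside[OF B] s ab by (auto simp: fun_eq_iff merge_cols_def split_col_def)
  have row: "{i. i \<noteq> r \<and> ?f (B, s) i a \<noteq> 0} = {s}" if s: "s \<in> S - {r}" for B s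
    using s by (auto simp: split_col_def)
  show "inj_on ?f ?D"
  proof (rule inj_onI)
    fix X Y assume XY: "X \<in> ?D" "Y \<in> ?D" "?f X = ?f Y"
    obtain B s B' s' where [simp]: "X = (B, s)" "Y = (B', s')" by (cases X, cases Y) blast
    have "B = B'" using merge[of B s] merge[of B' s'] XY by auto
    moreover have "{s} = {s'}" using row[of s B] row[of s' B'] XY by auto
    ultimately show "X = Y" by simp
  qed
  show "?f ` ?D = ?E"
  proof (intro equalityI subsetI)
    fix A assume "A \<in> ?f ` ?D"
    then obtain B s where "A = ?f (B, s)" and "B \<in> reg2 (S - {r}) (T - {b})"
      "s \<in> S - {r}" "B s a \<noteq> 0" by auto
    then show "A \<in> ?E"
      using split_col_in_reg2[OF _ fin r ab] by (auto simp: split_col_def)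
  next
    fix A assume "A \<in> ?E"
    then have A: "A \<in> reg2 S T" and one: "A r a = 1" "A r b = 1" by auto
    have "(\<Sum>i\<in>S - {r}. A i a) = 1"
      using sum.remove[of S r "\<lambda>i. A i a"] reg2_col_sum[OF A ab(1)] fin r one by simp
    then obtain s where s: "s \<in> S - {r}" "A s a = 1"
      and s0: "\<And>i. i \<in> S - {r} \<Longrightarrow> s \<noteq> i \<Longrightarrow> A i a = 0"
      using sum_eq_1_iff[of "S - {r}" "\<lambda>i. A i a"] fin by auto
    have s0': "A i a = 0" if "i \<noteq> r" "i \<noteq> s" for i
      using s0[of i] reg2_outside[OF A, of i a] that by (cases "i \<in> S") auto
    have "(\<Sum>k\<in>T - {a, b}. A r k) = 0"
      using sum_remove2[of T a b "A r"] reg2_row_sum[OF A r] fin ab one by simp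
    then have z: "A r k = 0" if "k \<noteq> a" "k \<noteq> b" for k
      using fin that reg2_outside[OF A, of r k] by (cases "k \<in> T") auto
    let ?B = "merge_cols r a b A"
    have "?f (?B, s) i k = A i k" for i k
      using one s s0'[of i] z[of k] ab by (auto simp: split_col_def merge_cols_def)
    then have "A = ?f (?B, s)" by (intro ext) simp
    moreover have "?B \<in> reg2 (S - {r}) (T - {b})"
      using merge_cols_in_reg2[OF A fin r ab one] .
    moreover have "?B s a \<noteq> 0" using s ab by (simp add: merge_cols_def)
    ultimately show "A \<in> ?f ` ?D" using s by auto
  qed
qed

lemma sum_of_bool_Collect:
  fixes f :: "'a \<Rightarrow> 'c::semiring_1"
  assumes "finite X"
  shows "(\<Sum>A\<in>X. f A * of_bool (P A)) = (\<Sum>A | A \<in> X \<and> P A. f A)"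
  using assms by (simp add: sum.inter_filter[symmetric] of_bool_def if_distrib cong: if_cong)

text \<open>
  Each merged matrix \<open>B\<close> is weighted by the number of rows \<open>s\<close> with \<open>B s a \<noteq> 0\<close>. The entries of column
  \<open>a\<close> lie in \<open>{0, 1, 2}\<close> and sum to \<open>2\<close>, so this number is \<open>2\<close> minus the number of entries equal to
  \<open>2\<close>; the matrices with such an entry are evaluated by \<open>weight_entry_two\<close>.
\<close>

lemma weight_two_ones:
  fixes x :: "'c::field_char_0"
  assumes fin: "finite S" "finite T" and r: "r \<in> S" and ab: "a \<in> T" "b \<in> T" "a \<noteq> b"
  shows "(\<Sum>A | A \<in> reg2 S T \<and> (A r a = 1 \<and> A r b = 1). x ^ ncomp T A) =
    2 * weight (S - {r}) (T - {b}) x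
      - (\<Sum>s\<in>S - {r}. x * weight (S - {r} - {s}) (T - {b} - {a}) x)"
proof -
  let ?S = "S - {r}" and ?T = "T - {b}"
  let ?R = "reg2 ?S ?T"
  let ?D = "SIGMA B:?R. {s \<in> ?S. B s a \<noteq> 0}"
  have finR: "finite ?R" using fin by (intro finite_reg2) auto
  have "(\<Sum>A | A \<in> reg2 S T \<and> (A r a = 1 \<and> A r b = 1). x ^ ncomp T A)
      = (\<Sum>X\<in>?D. x ^ ncomp T (split_col r a b X))"
    using sum.reindex_bij_betw[OF bij_split_col[OF fin r ab], of "\<lambda>A. x ^ ncomp T A"] by simp
  also have "\<dots> = (\<Sum>(B, s)\<in>?D. x ^ ncomp ?T B)"
    using ncomp_split_col[OF _ r ab] by (intro sum.cong) auto
  also have "\<dots> = (\<Sum>B\<in>?R. \<Sum>s | s \<in> ?S \<and> B s a \<noteq> 0. x ^ ncomp ?T B)"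
    using fin finR by (subst sum.Sigma) auto
  also have "\<dots> = (\<Sum>B\<in>?R. 2 * x ^ ncomp ?T B - (\<Sum>s\<in>?S. x ^ ncomp ?T B * of_bool (B s a = 2)))"
  proof (intro sum.cong refl)
    fix B assume B: "B \<in> ?R"
    have le: "B s a \<le> 2" if "s \<in> ?S" for s
      using member_le_sum[of s ?S "\<lambda>s. B s a"] reg2_col_sum[OF B, of a] fin ab that by simp
    have "(\<Sum>s\<in>?S. of_bool (B s a \<noteq> 0) + of_bool (B s a = 2)) = (\<Sum>s\<in>?S. B s a)"
    proof (intro sum.cong refl)
      fix s assume "s \<in> ?S"
      then have "B s a \<in> {0, 1, 2}" using le[of s] by auto
      then show "of_bool (B s a \<noteq> 0) + of_bool (B s a = 2) = B s a" by auto
    qed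
    also have "\<dots> = 2" using reg2_col_sum[OF B, of a] ab by auto
    finally have "(of_nat (\<Sum>s\<in>?S. of_bool (B s a \<noteq> 0) + of_bool (B s a = 2)) :: 'c) = of_nat 2"
      by (rule arg_cong)
    then have "(\<Sum>s\<in>?S. of_bool (B s a \<noteq> 0)) = 2 - (\<Sum>s\<in>?S. of_bool (B s a = 2) :: 'c)"
      unfolding sum.distrib of_nat_add of_nat_sum of_nat_of_bool by (simp add: eq_diff_eq)
    then have "x ^ ncomp ?T B * (\<Sum>s\<in>?S. of_bool (B s a \<noteq> 0))
        = x ^ ncomp ?T B * (2 - (\<Sum>s\<in>?S. of_bool (B s a = 2)))"
      by simp
    moreover have "(\<Sum>s | s \<in> ?S \<and> B s a \<noteq> 0. x ^ ncomp ?T B)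
        = x ^ ncomp ?T B * (\<Sum>s\<in>?S. of_bool (B s a \<noteq> 0))"
      unfolding sum_distrib_left using fin by (intro sum_of_bool_Collect[symmetric]) auto
    ultimately show "(\<Sum>s | s \<in> ?S \<and> B s a \<noteq> 0. x ^ ncomp ?T B)
        = 2 * x ^ ncomp ?T B - (\<Sum>s\<in>?S. x ^ ncomp ?T B * of_bool (B s a = 2))"
      unfolding sum_distrib_left[symmetric] by (simp only: right_diff_distrib mult.commute[of _ 2])
  qed
  also have "\<dots> = (\<Sum>B\<in>?R. 2 * x ^ ncomp ?T B)
      - (\<Sum>B\<in>?R. \<Sum>s\<in>?S. x ^ ncomp ?T B * of_bool (B s a = 2))"
    by (rule sum_subtractf)
  also have "(\<Sum>B\<in>?R. 2 * x ^ ncomp ?T B) = 2 * weight ?S ?T x"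
    unfolding weight_def sum_distrib_left ..
  also have "(\<Sum>B\<in>?R. \<Sum>s\<in>?S. x ^ ncomp ?T B * of_bool (B s a = 2))
      = (\<Sum>s\<in>?S. \<Sum>B\<in>?R. x ^ ncomp ?T B * of_bool (B s a = 2))"
    by (rule sum.swap)
  also have "(\<Sum>s\<in>?S. \<Sum>B\<in>?R. x ^ ncomp ?T B * of_bool (B s a = 2))
      = (\<Sum>s\<in>?S. x * weight (?S - {s}) (?T - {a}) x)"
    unfolding sum_of_bool_Collect[OF finR]
    using fin ab by (intro sum.cong refl weight_entry_two) auto
  finally show ?thesis .
qed

text \<open>
  Row \<open>r\<close> either has one entry \<open>2\<close>, or it has two entries \<open>1\<close> in a pair of columns that is counted twice
  as an ordered pair. So the indicators of the two cases, the second one halved, add up to \<open>1\<close>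
  on every matrix.
\<close>

lemma weight_recurrence:
  fixes x :: "'c::field_char_0"
  assumes fin: "finite S" "finite T" and r: "r \<in> S"
  shows "weight S T x = (\<Sum>c\<in>T. x * weight (S - {r}) (T - {c}) x)
    + (\<Sum>a\<in>T. \<Sum>b\<in>T - {a}. 2 * weight (S - {r}) (T - {b}) x
        - (\<Sum>s\<in>S - {r}. x * weight (S - {r} - {s}) (T - {b} - {a}) x)) / 2"
proof -
  let ?R = "reg2 S T"
  have finR: "finite ?R" using fin by (rule finite_reg2)
  have one: "(\<Sum>c\<in>T. of_bool (A r c = 2))
      + (\<Sum>a\<in>T. \<Sum>b\<in>T - {a}. of_bool (A r a = 1 \<and> A r b = 1)) / 2 = (1::'c)" if A: "A \<in> ?R" for A
  proof -
    have rs: "(\<Sum>c\<in>T. A r c) = 2" using reg2_row_sum[OF A r] .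
    have le: "A r c \<le> 2" if "c \<in> T" for c
      using member_le_sum[of c T "A r"] rs fin that by simp
    define u :: nat where "u = (\<Sum>c\<in>T. of_bool (A r c = 1))"
    define v :: nat where "v = (\<Sum>c\<in>T. of_bool (A r c = 2))"
    have "(\<Sum>c\<in>T. of_bool (A r c = 1) + 2 * of_bool (A r c = 2)) = (\<Sum>c\<in>T. A r c)"
    proof (intro sum.cong refl)
      fix c assume "c \<in> T"
      then have "A r c \<in> {0, 1, 2}" using le[of c] by auto
      then show "of_bool (A r c = 1) + 2 * of_bool (A r c = 2) = A r c" by auto
    qed
    then have uv: "u + 2 * v = 2"
      unfolding u_def v_def sum.distrib sum_distrib_left[symmetric] rs .
    have "(\<Sum>a\<in>T. \<Sum>b\<in>T - {a}. of_bool (A r a = 1 \<and> A r b = 1)) + u = u * u"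
    proof -
      have "(\<Sum>a\<in>T. \<Sum>b\<in>T - {a}. of_bool (A r a = 1 \<and> A r b = 1)) + u
          = (\<Sum>a\<in>T. (\<Sum>b\<in>T - {a}. of_bool (A r a = 1 \<and> A r b = 1)) + of_bool (A r a = 1))"
        unfolding u_def sum.distrib ..
      also have "\<dots> = (\<Sum>a\<in>T. \<Sum>b\<in>T. of_bool (A r a = 1 \<and> A r b = 1))"
      proof (intro sum.cong refl)
        fix a assume "a \<in> T"
        then show "(\<Sum>b\<in>T - {a}. of_bool (A r a = 1 \<and> A r b = 1)) + of_bool (A r a = 1)
            = (\<Sum>b\<in>T. of_bool (A r a = 1 \<and> A r b = 1) :: nat)"
          unfolding sum.remove[OF fin(2) \<open>a \<in> T\<close>, of "\<lambda>b. of_bool (A r a = 1 \<and> A r b = 1) :: nat"]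
          by (simp only: conj_absorb add.commute)
      qed
      also have "\<dots> = u * u"
        unfolding u_def sum_product of_bool_conj ..
      finally show ?thesis .
    qed
    moreover have "(u = 2 \<and> v = 0) \<or> (u = 0 \<and> v = 1)" using uv by presburger
    ultimately have "(v = 0 \<and> (\<Sum>a\<in>T. \<Sum>b\<in>T - {a}. of_bool (A r a = 1 \<and> A r b = 1)) = (2::nat))
       \<or> (v = 1 \<and> (\<Sum>a\<in>T. \<Sum>b\<in>T - {a}. of_bool (A r a = 1 \<and> A r b = 1)) = (0::nat))"
      by auto
    moreover have "(\<Sum>c\<in>T. of_bool (A r c = 2)) = (of_nat v :: 'c)"
      "(\<Sum>a\<in>T. \<Sum>b\<in>T - {a}. of_bool (A r a = 1 \<and> A r b = 1))
        = (of_nat (\<Sum>a\<in>T. \<Sum>b\<in>T - {a}. of_bool (A r a = 1 \<and> A r b = 1)) :: 'c)"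
      unfolding v_def of_nat_sum of_nat_of_bool by (rule refl)+
    ultimately show ?thesis by (elim disjE conjE) (simp_all only: of_nat_simps of_nat_numeral, simp_all)
  qed
  have "weight S T x = (\<Sum>A\<in>?R. x ^ ncomp T A * ((\<Sum>c\<in>T. of_bool (A r c = 2))
      + (\<Sum>a\<in>T. \<Sum>b\<in>T - {a}. of_bool (A r a = 1 \<and> A r b = 1)) / 2))"
    unfolding weight_def using one by (intro sum.cong refl) simp
  also have "\<dots> = (\<Sum>A\<in>?R. \<Sum>c\<in>T. x ^ ncomp T A * of_bool (A r c = 2))
      + (\<Sum>A\<in>?R. \<Sum>a\<in>T. \<Sum>b\<in>T - {a}. x ^ ncomp T A * of_bool (A r a = 1 \<and> A r b = 1)) / 2"
    by (simp only: distrib_left sum.distrib sum_distrib_left sum_divide_distrib times_divide_eq_right)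
  also have "(\<Sum>A\<in>?R. \<Sum>c\<in>T. x ^ ncomp T A * of_bool (A r c = 2))
      = (\<Sum>c\<in>T. \<Sum>A\<in>?R. x ^ ncomp T A * of_bool (A r c = 2))"
    by (rule sum.swap)
  also have "(\<Sum>A\<in>?R. \<Sum>a\<in>T. \<Sum>b\<in>T - {a}. x ^ ncomp T A * of_bool (A r a = 1 \<and> A r b = 1))
      = (\<Sum>a\<in>T. \<Sum>b\<in>T - {a}. \<Sum>A\<in>?R. x ^ ncomp T A * of_bool (A r a = 1 \<and> A r b = 1))"
    by (rule trans[OF sum.swap], intro sum.cong refl, rule sum.swap)
  also have "(\<Sum>c\<in>T. \<Sum>A\<in>?R. x ^ ncomp T A * of_bool (A r c = 2))
      = (\<Sum>c\<in>T. x * weight (S - {r}) (T - {c}) x)"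
    unfolding sum_of_bool_Collect[OF finR] using fin r by (intro sum.cong refl weight_entry_two) auto
  also have "(\<Sum>a\<in>T. \<Sum>b\<in>T - {a}. \<Sum>A\<in>?R. x ^ ncomp T A * of_bool (A r a = 1 \<and> A r b = 1))
      = (\<Sum>a\<in>T. \<Sum>b\<in>T - {a}. 2 * weight (S - {r}) (T - {b}) x
        - (\<Sum>s\<in>S - {r}. x * weight (S - {r} - {s}) (T - {b} - {a}) x))"
    unfolding sum_of_bool_Collect[OF finR] using fin r by (intro sum.cong refl weight_two_ones) auto
  finally show ?thesis .
qed

section \<open>The generating function of the weights\<close>

text \<open>The Taylor coefficients of \<open>(1 - z) powr (- y)\<close>.\<close>

definition rising_ratio :: "complex \<Rightarrow> nat \<Rightarrow> complex" where
  "rising_ratio y n = pochhammer y n / fact n"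

lemma rising_ratio_0 [simp]: "rising_ratio y 0 = 1"
  by (simp add: rising_ratio_def)

lemma rising_ratio_Suc: "rising_ratio y (Suc n) = rising_ratio y n * ((of_nat n + y) / of_nat (Suc n))"
  by (simp add: rising_ratio_def pochhammer_Suc field_simps)

text \<open>
  The series of \<open>exp (y z) * (1 - z) powr (- y)\<close>. With \<open>y = x / 2\<close> this is the exponential of
  \<open>x\<close> times \<open>z / 2 - ln (1 - z) / 2\<close>, whose \<open>k\<close>-th coefficient is the number of connected
  matrices of order \<open>k\<close> divided by \<open>(k!)\<^sup>2\<close>, namely \<open>1\<close> for \<open>k = 1\<close> and \<open>1 / (2 k)\<close> otherwise.
\<close>

definition comp_fps :: "complex \<Rightarrow> complex fps" where
  "comp_fps y = fps_exp y * Abs_fps (rising_ratio y)"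

lemma comp_fps_nth:
  "fps_nth (comp_fps y) n = (\<Sum>j\<le>n. y ^ j / fact j * rising_ratio y (n - j))"
  by (simp add: comp_fps_def fps_mult_nth atLeast0AtMost)

lemma comp_fps_0: "fps_nth (comp_fps y) 0 = 1"
  by (simp add: comp_fps_nth)

lemma comp_fps_ode: "(1 - fps_X) * fps_deriv (comp_fps y) = fps_const y * (2 - fps_X) * comp_fps y"
proof -
  let ?H = "Abs_fps (rising_ratio y)"
  have H: "(1 - fps_X) * fps_deriv ?H = fps_const y * ?H"
  proof (rule fps_ext)
    fix n
    have "of_nat (Suc n) * rising_ratio y (Suc n) = (of_nat n + y) * rising_ratio y n" for n
      by (simp add: rising_ratio_Suc del: of_nat_Suc)
    then show "fps_nth ((1 - fps_X) * fps_deriv ?H) n = fps_nth (fps_const y * ?H) n"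
      by (cases n) (simp_all add: left_diff_distrib fps_X_mult_nth algebra_simps del: of_nat_Suc)
  qed
  have "(1 - fps_X) * fps_deriv (comp_fps y)
      = (1 - fps_X) * (fps_const y * fps_exp y) * ?H + fps_exp y * ((1 - fps_X) * fps_deriv ?H)"
    by (simp add: comp_fps_def algebra_simps)
  also have "\<dots> = fps_const y * (2 - fps_X) * comp_fps y"
    unfolding H comp_fps_def by (simp add: algebra_simps)
  finally show ?thesis .
qed

lemma comp_fps_1: "fps_nth (comp_fps y) (Suc 0) = 2 * y"
  by (simp add: comp_fps_nth rising_ratio_Suc)

text \<open>With \<open>y = x / 2\<close> this is the recurrence of the weights after division by \<open>(n!)\<^sup>2\<close>.\<close>

lemma comp_fps_Suc_Suc:
  "of_nat (n + 2) * fps_nth (comp_fps y) (n + 2)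
     = (of_nat (n + 1) + 2 * y) * fps_nth (comp_fps y) (n + 1) - y * fps_nth (comp_fps y) n"
proof -
  have "fps_nth ((1 - fps_X) * fps_deriv (comp_fps y)) (Suc n)
      = fps_nth (fps_const y * ((2 - fps_X) * comp_fps y)) (Suc n)"
    by (simp only: comp_fps_ode mult.assoc)
  then show ?thesis
    by (simp add: left_diff_distrib fps_X_mult_nth algebra_simps numeral_fps_const)
qed

section \<open>Asymptotics of the coefficients\<close>

lemma rising_ratio_nonzero:
  assumes "Re y > 0"
  shows "rising_ratio y n \<noteq> 0"
proof -
  have "y \<noteq> - of_nat k" for k using assms by auto
  then show ?thesis by (auto simp: rising_ratio_def pochhammer_eq_0_iff)
qed

text \<open>
  One step back multiplies by \<open>(m + 1) / \<bar>m + y\<bar>\<close>, which is at most \<open>1 / c\<close> because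
  \<open>m + c \<ge> c (m + 1)\<close> for \<open>c \<le> 1\<close>. The bound does not depend on \<open>n\<close>, which makes it usable for
  dominated convergence.
\<close>

lemma norm_rising_ratio_back:
  assumes c: "0 < c" "c \<le> 1" "c \<le> Re y" and "j \<le> n"
  shows "norm (rising_ratio y (n - j)) \<le> (1 / c) ^ j * norm (rising_ratio y n)"
  using \<open>j \<le> n\<close>
proof (induction j)
  case (Suc j)
  define m where "m = n - Suc j"
  have m: "n - j = Suc m" using Suc.prems by (simp add: m_def)
  have "c * real (Suc m) \<le> real m + c"
    using c mult_right_mono[of c 1 "real m"] by (simp add: algebra_simps)
  also have "\<dots> \<le> Re (of_nat m + y)" using c by simp
  also have "\<dots> \<le> norm (of_nat m + y)" by (rule complex_Re_le_cmod)
  finally have "c \<le> norm ((of_nat m + y) / of_nat (Suc m))"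
    by (simp add: norm_divide field_simps del: of_nat_Suc)
  then have "c * norm (rising_ratio y m) \<le> norm (rising_ratio y (Suc m))"
    unfolding rising_ratio_Suc norm_mult by (metis mult.commute mult_left_mono norm_ge_zero)
  then have "norm (rising_ratio y m) \<le> (1 / c) * norm (rising_ratio y (Suc m))"
    using c by (simp add: field_simps)
  also have "\<dots> \<le> (1 / c) * ((1 / c) ^ j * norm (rising_ratio y n))"
    using Suc c m by (intro mult_left_mono) auto
  finally show ?case by (simp add: m_def)
qed simp

lemma rising_ratio_shift_tendsto:
  fixes y :: "nat \<Rightarrow> complex"
  assumes y: "y \<longlonglongrightarrow> y0" and pos: "Re y0 > 0"
  shows "(\<lambda>n. rising_ratio (y n) (n - j) / rising_ratio (y n) n) \<longlonglongrightarrow> 1"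
proof (induction j)
  case 0
  have "\<forall>\<^sub>F n in sequentially. Re (y n) > 0"
    using order_tendstoD(1)[OF tendsto_Re[OF y] pos] .
  then have "\<forall>\<^sub>F n in sequentially. 1 = rising_ratio (y n) (n - 0) / rising_ratio (y n) n"
    by eventually_elim (simp add: rising_ratio_nonzero)
  then show ?case by (rule Lim_transform_eventually[OF tendsto_const])
next
  case (Suc j)
  have ev: "\<forall>\<^sub>F n in sequentially. Re (y n) > 0"
    using order_tendstoD(1)[OF tendsto_Re[OF y] pos] .
  have lim: "(\<lambda>n. inverse (of_nat (n - j))) \<longlonglongrightarrow> (0::complex)"
    by (rule LIMSEQ_offset[of _ j]) (simp add: lim_inverse_n)
  have "(\<lambda>n. inverse (1 + (y n - 1) * inverse (of_nat (n - j)))) \<longlonglongrightarrow> inverse (1 + (y0 - 1) * 0)"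
    by (intro tendsto_intros lim y) simp
  then have "(\<lambda>n. rising_ratio (y n) (n - j) / rising_ratio (y n) n *
      inverse (1 + (y n - 1) * inverse (of_nat (n - j)))) \<longlonglongrightarrow> 1 * 1"
    by (intro tendsto_mult Suc) simp
  moreover have "\<forall>\<^sub>F n in sequentially. rising_ratio (y n) (n - j) / rising_ratio (y n) n *
      inverse (1 + (y n - 1) * inverse (of_nat (n - j)))
      = rising_ratio (y n) (n - Suc j) / rising_ratio (y n) n"
    using ev eventually_gt_at_top[of j]
  proof eventually_elim
    case (elim n)
    define m where "m = n - Suc j"
    have m: "n - j = Suc m" using elim by (simp add: m_def)
    have nz: "of_nat m + y n \<noteq> 0" using elim(1) by (auto simp: complex_eq_iff)
    have "1 + (y n - 1) * inverse (of_nat (Suc m)) = (of_nat m + y n) / of_nat (Suc m)"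
      using of_nat_neq_0[of m, where ?'a = complex] by (simp add: field_simps)
    then show ?case
      unfolding m m_def[symmetric] rising_ratio_Suc using nz by (simp del: of_nat_Suc)
  qed
  ultimately show ?case by (simp add: Lim_transform_eventually)
qed

text \<open>
  The \<open>n\<close>-th coefficient divided by \<open>rising_ratio\<close> is the sum of \<open>y ^ k / k!\<close> times a quotient that
  tends to \<open>1\<close> for fixed \<open>k\<close>. Tannery's theorem passes to the limit under the sum with the
  majorant \<open>(B / c) ^ k / k!\<close>, where \<open>B\<close> bounds the sequence \<open>y\<close> and \<open>c\<close> is eventually a
  lower bound for its real parts.
\<close>

lemma comp_fps_over_rising_ratio_tendsto:
  fixes y :: "nat \<Rightarrow> complex"
  assumes y: "y \<longlonglongrightarrow> y0" and pos: "Re y0 > 0"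
  shows "(\<lambda>n. fps_nth (comp_fps (y n)) n / rising_ratio (y n) n) \<longlonglongrightarrow> exp y0"
proof -
  define c where "c = min 1 (Re y0 / 2)"
  have c: "0 < c" "c \<le> 1" "c < Re y0" using pos by (auto simp: c_def)
  obtain B where B: "\<And>n. norm (y n) \<le> B"
    using Bseq_def convergent_imp_Bseq convergentI[OF y] by (metis)
  define a where "a k n = (if k \<le> n then y n ^ k / fact k *
      (rising_ratio (y n) (n - k) / rising_ratio (y n) n) else 0)" for k n
  define M where "M k = (B / c) ^ k / fact k" for k
  have ev: "\<forall>\<^sub>F n in sequentially. c \<le> Re (y n)"
    using order_tendstoD(1)[OF tendsto_Re[OF y] c(3)] by (rule eventually_mono) simp
  have lim: "((\<lambda>n. a k n) \<longlongrightarrow> y0 ^ k / fact k) sequentially" for k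
  proof -
    have "(\<lambda>n. y n ^ k / fact k * (rising_ratio (y n) (n - k) / rising_ratio (y n) n))
        \<longlonglongrightarrow> y0 ^ k / fact k * 1"
      by (intro tendsto_mult rising_ratio_shift_tendsto[OF y pos] tendsto_divide tendsto_power y
          tendsto_const) simp
    moreover have "\<forall>\<^sub>F n in sequentially. y n ^ k / fact k *
        (rising_ratio (y n) (n - k) / rising_ratio (y n) n) = a k n"
      using eventually_ge_at_top[of k] by eventually_elim (simp add: a_def)
    ultimately show ?thesis by (simp add: Lim_transform_eventually)
  qed
  have bound: "norm (a k n) \<le> M k" if n: "c \<le> Re (y n)" for k n
  proof (cases "k \<le> n")
    case True
    have B0: "0 \<le> B" using B[of 0] norm_ge_zero order_trans by blast
    have "norm (rising_ratio (y n) (n - k) / rising_ratio (y n) n) \<le> (1 / c) ^ k"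
      using norm_rising_ratio_back[OF c(1,2) n True] rising_ratio_nonzero[of "y n" n] n c
      by (simp add: norm_divide field_simps)
    moreover have "norm (y n) ^ k / fact k \<le> B ^ k / fact k"
      by (intro divide_right_mono power_mono B) auto
    ultimately have "norm (y n) ^ k / fact k * norm (rising_ratio (y n) (n - k) / rising_ratio (y n) n)
        \<le> B ^ k / fact k * (1 / c) ^ k"
      using B0 by (intro mult_mono) auto
    also have "norm (y n) ^ k / fact k * norm (rising_ratio (y n) (n - k) / rising_ratio (y n) n)
        = norm (a k n)"
      using True by (simp add: a_def norm_mult norm_divide norm_power)
    finally have "norm (a k n) \<le> B ^ k / fact k * (1 / c) ^ k" .
    then show ?thesis by (simp add: M_def power_divide mult.commute)
  next
    case False
    have "0 \<le> B" using B[of 0] norm_ge_zero order_trans by blast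
    then show ?thesis using False c by (simp add: a_def M_def)
  qed
  have "summable M"
    unfolding M_def using summable_exp[of "B / c"] by (simp add: divide_inverse mult.commute)
  moreover have "\<forall>\<^sub>F (k, n) in at_top \<times>\<^sub>F sequentially. norm (a k n) \<le> M k"
    unfolding eventually_prod_filter
    by (intro exI[of _ "\<lambda>_. True"] exI[of _ "\<lambda>n. c \<le> Re (y n)"]) (use ev bound in simp)
  ultimately have "(\<lambda>n. suminf (\<lambda>k. a k n)) \<longlonglongrightarrow> suminf (\<lambda>k. y0 ^ k / fact k)"
    using tannerys_theorem[of a "\<lambda>k. y0 ^ k / fact k" sequentially M] lim by simp
  moreover have "suminf (\<lambda>k. a k n) = fps_nth (comp_fps (y n)) n / rising_ratio (y n) n" for n
  proof -
    have "suminf (\<lambda>k. a k n) = (\<Sum>k\<le>n. a k n)"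
      by (rule suminf_finite) (auto simp: a_def)
    also have "\<dots> = fps_nth (comp_fps (y n)) n / rising_ratio (y n) n"
      unfolding comp_fps_nth sum_divide_distrib by (intro sum.cong) (auto simp: a_def)
    finally show ?thesis .
  qed
  moreover have "suminf (\<lambda>k. y0 ^ k / fact k) = exp y0"
    by (simp add: exp_def scaleR_conv_of_real divide_inverse mult.commute)
  ultimately show ?thesis by simp
qed

lemma summable_Suc_squares: "summable (\<lambda>m. 1 / real (Suc m) ^ 2)"
  using summable_Suc_iff[of "\<lambda>m. 1 / real m ^ 2"] inverse_power_summable[of 2, where ?'a = real]
  by (simp add: divide_inverse)

text \<open>
  The terms differ from those of the harmonic sum by a summable amount, and the harmonic sum minus
  \<open>ln n\<close> converges to the Euler-Mascheroni constant.
\<close>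

lemma shifted_harmonic_bounded: "\<exists>K. \<forall>n. \<bar>(\<Sum>m<n. 1 / (real m + 1/2)) - ln (real n)\<bar> \<le> K"
proof -
  have "summable (\<lambda>m. 1 / (real m + 1/2) - 1 / real (Suc m))"
  proof (rule summable_comparison_test'[OF summable_Suc_squares])
    fix m :: nat
    have "1 / (real m + 1/2) - 1 / real (Suc m) = 1 / ((2 * real m + 1) * (real m + 1))"
      by (simp add: divide_simps) (simp add: algebra_simps)
    moreover have "real (Suc m) ^ 2 \<le> (2 * real m + 1) * (real m + 1)"
      by (simp add: power2_eq_square algebra_simps)
    ultimately show "norm (1 / (real m + 1/2) - 1 / real (Suc m)) \<le> 1 / real (Suc m) ^ 2"
      by (simp add: frac_le)
  qed
  then have "convergent (\<lambda>n. \<Sum>m<n. 1 / (real m + 1/2) - 1 / real (Suc m))"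
    by (simp add: summable_iff_convergent)
  then have "convergent (\<lambda>n. (\<Sum>m<n. 1 / (real m + 1/2) - 1 / real (Suc m)) + (harm n - ln (real n)))"
    by (rule convergent_add[OF _ euler_mascheroni_convergent])
  moreover have "(\<Sum>m<n. 1 / (real m + 1/2) - 1 / real (Suc m)) + (harm n - ln (real n))
      = (\<Sum>m<n. 1 / (real m + 1/2)) - ln (real n)" for n
    unfolding sum_subtractf harm_altdef inverse_eq_divide by simp
  ultimately have "Bseq (\<lambda>n. (\<Sum>m<n. 1 / (real m + 1/2)) - ln (real n))"
    by (simp only: convergent_imp_Bseq)
  then show ?thesis by (auto simp: Bseq_def)
qed

lemma shifted_square_sum_bounded: "(\<Sum>m<n. 1 / (real m + 1/2) ^ 2) \<le> 4 * (\<Sum>m. 1 / real (Suc m) ^ 2)"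
proof -
  have "(\<Sum>m<n. 1 / (real m + 1/2) ^ 2) \<le> (\<Sum>m<n. 4 * (1 / real (Suc m) ^ 2))"
  proof (rule sum_mono)
    fix m
    have "real (Suc m) ^ 2 \<le> (2 * (real m + 1/2)) ^ 2" by (intro power_mono) auto
    then have "real (Suc m) ^ 2 \<le> 4 * (real m + 1/2) ^ 2" unfolding power_mult_distrib by simp
    then show "1 / (real m + 1/2) ^ 2 \<le> 4 * (1 / real (Suc m) ^ 2)"
      by (simp add: divide_simps)
  qed
  also have "\<dots> = 4 * (\<Sum>m<n. 1 / real (Suc m) ^ 2)" by (simp only: sum_distrib_left)
  also have "\<dots> \<le> 4 * (\<Sum>m. 1 / real (Suc m) ^ 2)"
    by (intro mult_left_mono sum_le_suminf summable_Suc_squares) auto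
  finally show ?thesis by simp
qed

text \<open>
  The quotient is the product of the factors \<open>1 + u\<close> with \<open>u = d / (m + 1/2)\<close>. Replacing \<open>ln (1 + u)\<close> by
  \<open>u\<close> costs \<open>O(\<bar>d\<bar>\<^sup>2)\<close> in total, because the squares \<open>1 / (m + 1/2)\<^sup>2\<close> are summable, and replacing the
  sum of the \<open>u\<close> by \<open>d ln n\<close> costs \<open>O(\<bar>d\<bar>)\<close>.
\<close>

lemma rising_ratio_quotient_tendsto:
  fixes d :: "nat \<Rightarrow> complex"
  assumes d: "d \<longlonglongrightarrow> 0"
  shows "(\<lambda>n. rising_ratio (1/2 + d n) n / rising_ratio (1/2) n * exp (- d n * of_real (ln (real n)))) \<longlonglongrightarrow> 1"
proof -
  obtain K where K: "\<And>n. \<bar>(\<Sum>m<n. 1 / (real m + 1/2)) - ln (real n)\<bar> \<le> K"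
    using shifted_harmonic_bounded by blast
  define L where "L = 4 * (\<Sum>m. 1 / real (Suc m) ^ 2)"
  define u where "u n m = d n * of_real (1 / (real m + 1/2))" for n m
  \<comment> \<open>\<open>E n\<close> is a logarithm of the expression whose limit is sought, once \<open>d n\<close> is small.\<close>
  define E where "E n = (\<Sum>m<n. ln (1 + u n m) - u n m)
      + d n * of_real ((\<Sum>m<n. 1 / (real m + 1/2)) - ln (real n))" for n
  have ev: "\<forall>\<^sub>F n in sequentially. norm (d n) < 1/4"
    using order_tendstoD(2)[OF tendsto_norm_zero[OF d], of "1/4"] by simp
  have u: "norm (u n m) = norm (d n) * (1 / (real m + 1/2))" for n m
    by (simp add: u_def norm_mult norm_divide del: of_real_add)
  have u2: "norm (u n m) \<le> 1/2" if "norm (d n) < 1/4" for n m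
  proof -
    have "norm (d n) * (1 / (real m + 1/2)) \<le> 1/4 * 2"
      using that by (intro mult_mono) (auto simp: divide_simps)
    then show ?thesis by (simp add: u)
  qed
  have "\<forall>\<^sub>F n in sequentially. norm (E n) \<le> 2 * norm (d n) ^ 2 * L + norm (d n) * K"
    using ev
  proof eventually_elim
    case (elim n)
    have "norm (ln (1 + u n m) - u n m) \<le> 2 * norm (d n) ^ 2 * (1 / (real m + 1/2) ^ 2)" for m
    proof -
      have "norm (ln (1 + u n m) - u n m) \<le> norm (u n m) ^ 2 / (1 - norm (u n m))"
        using u2[OF elim, of m] by (intro Ln_approx_linear) simp
      also have "\<dots> \<le> norm (u n m) ^ 2 / (1/2)"
        using u2[OF elim, of m] by (intro divide_left_mono) auto
      finally show ?thesis by (simp add: u power_mult_distrib power_divide mult.commute)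
    qed
    then have "norm (\<Sum>m<n. ln (1 + u n m) - u n m)
        \<le> (\<Sum>m<n. 2 * norm (d n) ^ 2 * (1 / (real m + 1/2) ^ 2))"
      by (intro sum_norm_le)
    also have "\<dots> = 2 * norm (d n) ^ 2 * (\<Sum>m<n. 1 / (real m + 1/2) ^ 2)"
      by (rule sum_distrib_left[symmetric])
    also have "\<dots> \<le> 2 * norm (d n) ^ 2 * L"
      unfolding L_def by (intro mult_left_mono shifted_square_sum_bounded) auto
    finally have 1: "norm (\<Sum>m<n. ln (1 + u n m) - u n m) \<le> 2 * norm (d n) ^ 2 * L" .
    have "norm (d n * of_real ((\<Sum>m<n. 1 / (real m + 1/2)) - ln (real n))) \<le> norm (d n) * K"
      unfolding norm_mult norm_of_real by (intro mult_left_mono K) auto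
    then show ?case unfolding E_def using 1 norm_triangle_mono by blast
  qed
  moreover have "(\<lambda>n. 2 * norm (d n) ^ 2 * L + norm (d n) * K) \<longlonglongrightarrow> 2 * 0 ^ 2 * L + 0 * K"
    using tendsto_norm_zero[OF d] by (intro tendsto_intros)
  ultimately have "E \<longlonglongrightarrow> 0"
    by (intro Lim_null_comparison[of E]) auto
  then have "(\<lambda>n. exp (E n)) \<longlonglongrightarrow> exp 0" by (rule tendsto_exp)
  moreover have "\<forall>\<^sub>F n in sequentially. exp (E n) =
      rising_ratio (1/2 + d n) n / rising_ratio (1/2) n * exp (- d n * of_real (ln (real n)))"
    using ev
  proof eventually_elim
    case (elim n)
    have nz: "1 + u n m \<noteq> 0" for m
    proof
      assume "1 + u n m = 0"
      then have "norm (u n m) = 1" by (metis add_eq_0_iff norm_minus_cancel norm_one)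
      then show False using u2[OF elim, of m] by simp
    qed
    have "rising_ratio (1/2 + d n) n / rising_ratio (1/2) n
        = (\<Prod>m<n. (1/2 + d n + of_nat m) / (1/2 + of_nat m))"
      by (simp add: rising_ratio_def pochhammer_prod prod_dividef atLeast0LessThan)
    also have "\<dots> = (\<Prod>m<n. 1 + u n m)"
    proof (rule prod.cong[OF refl])
      fix m
      define q :: complex where "q = of_real (real m + 1/2)"
      have q: "1/2 + of_nat m = q" by (simp add: q_def)
      have nz: "q \<noteq> 0"
        unfolding q_def of_real_eq_0_iff using of_nat_0_le_iff[of m, where ?'a = real] by linarith
      have un: "u n m = d n * (1 / q)"
        unfolding u_def q_def of_real_divide of_real_1 ..
      have num: "1/2 + d n + of_nat m = q + d n"
        unfolding q[symmetric] by (simp only: add_ac)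
      show "(1/2 + d n + of_nat m) / (1/2 + of_nat m) = 1 + u n m"
        unfolding un q num using nz by (simp add: add_divide_distrib)
    qed
    also have "\<dots> = exp (\<Sum>m<n. ln (1 + u n m))"
      using nz by (simp add: exp_sum)
    finally have "rising_ratio (1/2 + d n) n / rising_ratio (1/2) n * exp (- d n * of_real (ln (real n)))
        = exp ((\<Sum>m<n. ln (1 + u n m)) - d n * of_real (ln (real n)))"
      by (simp add: exp_diff exp_minus field_simps)
    also have "(\<Sum>m<n. ln (1 + u n m)) - d n * of_real (ln (real n)) = E n"
    proof -
      have "(\<Sum>m<n. u n m) = d n * of_real (\<Sum>m<n. 1 / (real m + 1/2))"
        unfolding u_def of_real_sum sum_distrib_left ..
      then show ?thesis
        unfolding E_def sum_subtractf of_real_diff right_diff_distrib by (simp only: diff_add_eq) simp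
    qed
    finally show ?case ..
  qed
  ultimately show ?thesis by (simp add: Lim_transform_eventually)
qed

text \<open>
  The factors \<open>exp y\<close> of the coefficient asymptotics cancel in the limit, since \<open>y\<close> tends to \<open>1/2\<close>;
  only the quotient of the coefficients of the two binomial series remains.
\<close>

lemma comp_fps_quotient_tendsto:
  fixes d :: "nat \<Rightarrow> complex"
  assumes d: "d \<longlonglongrightarrow> 0"
  shows "(\<lambda>n. fps_nth (comp_fps (1/2 + d n)) n / fps_nth (comp_fps (1/2)) n
            * exp (- d n * of_real (ln (real n)))) \<longlonglongrightarrow> 1"
proof -
  have y: "(\<lambda>n. 1/2 + d n) \<longlonglongrightarrow> 1/2"
    using tendsto_add[OF tendsto_const d, of "1/2"] by simp
  have "\<forall>\<^sub>F n in sequentially. Re (1/2 + d n) > 0"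
    using order_tendstoD(1)[OF tendsto_Re[OF y], of 0] by simp
  then have ev: "\<forall>\<^sub>F n in sequentially. rising_ratio (1/2 + d n) n \<noteq> 0"
    by eventually_elim (rule rising_ratio_nonzero)
  have nz: "rising_ratio (1/2) n \<noteq> 0" for n by (rule rising_ratio_nonzero) simp
  have "(\<lambda>n. fps_nth (comp_fps (1/2 + d n)) n / rising_ratio (1/2 + d n) n
      / (fps_nth (comp_fps (1/2)) n / rising_ratio (1/2) n)
      * (rising_ratio (1/2 + d n) n / rising_ratio (1/2) n * exp (- d n * of_real (ln (real n)))))
      \<longlonglongrightarrow> exp (1/2) / exp (1/2) * 1"
    by (intro tendsto_mult tendsto_divide rising_ratio_quotient_tendsto d
        comp_fps_over_rising_ratio_tendsto y tendsto_const) auto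
  moreover have "\<forall>\<^sub>F n in sequentially. fps_nth (comp_fps (1/2 + d n)) n / rising_ratio (1/2 + d n) n
      / (fps_nth (comp_fps (1/2)) n / rising_ratio (1/2) n)
      * (rising_ratio (1/2 + d n) n / rising_ratio (1/2) n * exp (- d n * of_real (ln (real n))))
      = fps_nth (comp_fps (1/2 + d n)) n / fps_nth (comp_fps (1/2)) n
            * exp (- d n * of_real (ln (real n)))"
    using ev by eventually_elim (use nz in \<open>simp add: field_simps\<close>)
  ultimately show ?thesis by (simp add: Lim_transform_eventually)
qed

text \<open>
  The exponent of the standardised Poisson characteristic function with mean \<open>s\<^sup>2\<close>. Its
  distance to the limit is at most \<open>\<bar>t\<bar> ^ 3 / (6 s)\<close> by Taylor's formula.
\<close>

lemma iexp_second_order_tendsto: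
  fixes s :: "nat \<Rightarrow> real"
  assumes s: "filterlim s at_top sequentially"
  shows "(\<lambda>n. of_real (s n ^ 2) * (iexp (t / s n) - 1) - \<i> * of_real (t * s n)) \<longlonglongrightarrow> of_real (- (t\<^sup>2) / 2)"
proof -
  have "\<forall>\<^sub>F n in sequentially. norm (of_real (s n ^ 2) * (iexp (t / s n) - 1) - \<i> * of_real (t * s n)
      - of_real (- (t\<^sup>2) / 2)) \<le> \<bar>t\<bar> ^ 3 / 6 * inverse (s n)"
    using filterlim_at_top_dense[THEN iffD1, OF s, rule_format, of 0]
  proof eventually_elim
    case (elim n)
    define x where "x = t / s n"
    have tx: "t = x * s n" using elim by (simp add: x_def)
    have "norm (iexp x - (\<Sum>k\<le>2. (\<i> * x) ^ k / fact k)) \<le> \<bar>x\<bar> ^ 3 / 6"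
      using iexp_approx1[of x 2] by (simp add: numeral_eq_Suc)
    moreover have "(\<Sum>k\<le>2. (\<i> * x) ^ k / fact k) = 1 + \<i> * x - of_real (x\<^sup>2 / 2)"
      by (simp add: numeral_2_eq_2 power2_eq_square algebra_simps)
    ultimately have "norm (iexp x - (1 + \<i> * x - of_real (x\<^sup>2 / 2))) \<le> \<bar>x\<bar> ^ 3 / 6" by simp
    then have "s n ^ 2 * norm (iexp x - (1 + \<i> * x - of_real (x\<^sup>2 / 2))) \<le> s n ^ 2 * (\<bar>x\<bar> ^ 3 / 6)"
      by (intro mult_left_mono) auto
    moreover have "of_real (s n ^ 2) * (iexp x - 1) - \<i> * of_real (t * s n) - of_real (- (t\<^sup>2) / 2)
        = of_real (s n ^ 2) * (iexp x - (1 + \<i> * x - of_real (x\<^sup>2 / 2)))"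
      unfolding tx by (simp add: algebra_simps power2_eq_square)
    moreover have "s n ^ 2 * (\<bar>x\<bar> ^ 3 / 6) = \<bar>t\<bar> ^ 3 / 6 * inverse (s n)"
      using elim by (simp add: x_def field_simps power2_eq_square power3_eq_cube abs_mult)
    ultimately show ?case unfolding x_def[symmetric]
      by (simp only: norm_mult norm_of_real) simp
  qed
  moreover have "(\<lambda>n. \<bar>t\<bar> ^ 3 / 6 * inverse (s n)) \<longlonglongrightarrow> 0"
    by (rule tendsto_mult_right_zero[OF tendsto_inverse_0_at_top[OF s]])
  ultimately show ?thesis
    by (rule LIM_zero_cancel[OF Lim_null_comparison])
qed

section \<open>The distribution of the number of components\<close>

lemma weight_empty: "weight ({} :: 'a set) ({} :: 'b set) x = 1"
proof -
  have "reg2 {} {} = {\<lambda>(_::'a) (_::'b). 0 :: nat}" by (auto simp: reg2_def fun_eq_iff)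
  moreover have "minimal_members (closed_cols {} B) = {}" for B :: "'a \<Rightarrow> 'b \<Rightarrow> nat"
    by (auto simp: minimal_members_def closed_cols_def)
  ultimately show ?thesis by (simp add: weight_def ncomp_def)
qed

text \<open>
  All index sets on the right of the recurrence have sizes \<open>n - 1\<close> or \<open>n - 2\<close>, so by induction their
  weights are constants \<open>w (n - 1)\<close> and \<open>w (n - 2)\<close>, and only the number of terms has to be counted.
\<close>

lemma weight_eq_coeff:
  fixes x :: complex
  assumes "finite S" "finite T" "card S = n" "card T = n"
  shows "weight S T x = fact n ^ 2 * fps_nth (comp_fps (x / 2)) n"
  using assms
proof (induction n arbitrary: S T rule: less_induct)
  case (less n)
  define w where "w m = fact m ^ 2 * fps_nth (comp_fps (x / 2)) m" for m
  show ?case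
  proof (cases n)
    case 0
    then show ?thesis using less.prems by (simp add: weight_empty comp_fps_0)
  next
    case (Suc m)
    then obtain r where r: "r \<in> S" using less.prems by (metis card.empty ex_in_conv nat.distinct(1))
    note fin = less.prems(1,2)
    have w1: "weight (S - {r}) (T - {c}) x = w m" if "c \<in> T" for c
      unfolding w_def using less.prems r that Suc by (intro less.IH) auto
    have w2: "weight (S - {r} - {s}) (T - {b} - {a}) x = w (m - 1)"
      if "a \<in> T" "b \<in> T - {a}" "s \<in> S - {r}" for a b s
      unfolding w_def using less.prems r that Suc by (intro less.IH) auto
    have "weight S T x = (\<Sum>c\<in>T. x * w m)
        + (\<Sum>a\<in>T. \<Sum>b\<in>T - {a}. 2 * w m - (\<Sum>s\<in>S - {r}. x * w (m - 1))) / 2"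
      unfolding weight_recurrence[OF fin r] using w1 w2
      by (intro arg_cong2[where f = "(+)"] arg_cong2[where f = "(/)"] sum.cong refl
          arg_cong2[where f = "(-)"]) auto
    also have "\<dots> = of_nat (Suc m) * x * w m
        + of_nat (Suc m) * (of_nat m * (2 * w m - of_nat m * (x * w (m - 1)))) / 2"
      using less.prems r Suc by simp
    \<comment> \<open>For \<open>m = 0\<close> the truncated \<open>m - 1\<close> is harmless, as the second summand has the factor \<open>m\<close>.\<close>
    also have "\<dots> = w (Suc m)"
    proof (cases m)
      case 0
      then show ?thesis by (simp add: w_def comp_fps_0 comp_fps_1)
    next
      case (Suc k)
      define p where "p i = fps_nth (comp_fps (x / 2)) i" for i
      define c where "c = (of_nat k :: complex)"
      have rec: "(c + 2) * p (k + 2) = (c + 1 + x) * p (k + 1) - x / 2 * p k"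
        using comp_fps_Suc_Suc[of k "x / 2"] by (simp add: p_def c_def add_ac)
      have f: "fact (k + 1) = (c + 1) * fact k" "fact (k + 2) = (c + 2) * ((c + 1) * fact k)"
        by (simp_all add: c_def add_ac)
      have "w (Suc m) = (c + 2) * ((c + 1) * fact k) ^ 2 * ((c + 2) * p (k + 2))"
        using f Suc by (simp add: w_def p_def[symmetric] power2_eq_square)
      also have "\<dots> = (c + 2) * x * (((c + 1) * fact k) ^ 2 * p (k + 1)) + (c + 2) * ((c + 1) *
          (2 * (((c + 1) * fact k) ^ 2 * p (k + 1)) - (c + 1) * (x * (fact k ^ 2 * p k)))) / 2"
        unfolding rec by (simp add: field_simps power2_eq_square)
      finally show ?thesis
        using f Suc by (simp add: w_def p_def c_def add_ac)
    qed
    finally show ?thesis by (simp add: w_def Suc)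
  qed
qed

lemma sum_M2_pow_num_components:
  fixes x :: complex
  shows "(\<Sum>A\<in>M2 n. x ^ num_components n A) = fact n ^ 2 * fps_nth (comp_fps (x / 2)) n"
proof -
  have "(\<Sum>A\<in>M2 n. x ^ num_components n A) = weight {1..n} {1..n} x"
    unfolding weight_def M2_eq_reg2
    by (intro sum.cong refl) (simp add: num_components_eq_ncomp M2_eq_reg2)
  also have "\<dots> = fact n ^ 2 * fps_nth (comp_fps (x / 2)) n"
    by (intro weight_eq_coeff) auto
  finally show ?thesis .
qed

lemma mean_M2_pow_num_components:
  fixes x :: complex
  shows "(\<Sum>A\<in>M2 n. x ^ num_components n A) / of_nat (card (M2 n))
    = fps_nth (comp_fps (x / 2)) n / fps_nth (comp_fps (1 / 2)) n"
proof -
  have "of_nat (card (M2 n)) = fact n ^ 2 * fps_nth (comp_fps (1 / 2)) n"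
    using sum_M2_pow_num_components[of 1 n] by simp
  then show ?thesis by (simp add: sum_M2_pow_num_components)
qed

theorem theorem2p8:
  fixes \<Omega> :: "nat \<Rightarrow> 'w measure"
    and A :: "nat \<Rightarrow> 'w \<Rightarrow> (nat \<Rightarrow> nat \<Rightarrow> nat)"
  assumes "\<And>n. n \<ge> 2 \<Longrightarrow> prob_space (\<Omega> n)"
    and "\<And>n. n \<ge> 2 \<Longrightarrow> A n \<in> \<Omega> n \<rightarrow>\<^sub>M count_space (M2 n)"
    and "\<And>n. n \<ge> 2 \<Longrightarrow> distr (\<Omega> n) (count_space (M2 n)) (A n) = uniform_count_measure (M2 n)"
  shows "weak_conv_m
    (\<lambda>n. distr (\<Omega> n) borel
       (\<lambda>\<omega>. (real (num_components n (A n \<omega>)) - 1/2 * ln (real n)) / sqrt (1/2 * ln (real n))))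
    std_normal_distribution"
proof -
  define s where "s n = sqrt (1/2 * ln (real n))" for n
  define X where "X n B = (real (num_components n B) - 1/2 * ln (real n)) / s n" for n B
  define M where "M n = distr (\<Omega> n) borel (\<lambda>\<omega>. X n (A n \<omega>))" for n
  define x where "x t n = iexp (t / s n)" for t n
  define d where "d t n = (x t n - 1) / 2" for t n
  have X_meas: "X n \<in> count_space (M2 n) \<rightarrow>\<^sub>M borel" for n by simp
  have s_top: "filterlim s at_top sequentially"
    unfolding s_def by real_asymp
  \<comment> \<open>Centring and scaling turn the mean of \<open>x ^ C\<close> at \<open>x = exp (\<i> t / s)\<close> into the characteristic
    function; the centring contributes \<open>exp (- \<i> t s)\<close> because \<open>ln n / 2 = s\<^sup>2\<close>.\<close>
  have char_M: "char (M n) t = fps_nth (comp_fps (1/2 + d t n)) n / fps_nth (comp_fps (1/2)) n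
      * exp (- \<i> * of_real (t * s n))" if n: "n \<ge> 2" for n t
  proof -
    have sn: "s n > 0" "1/2 * ln (real n) = s n * s n" using n by (simp_all add: s_def)
    have half: "x t n / 2 = 1/2 + d t n" by (simp add: d_def diff_divide_distrib)
    have "char (M n) t = (CLINT y|distr (distr (\<Omega> n) (count_space (M2 n)) (A n)) borel (X n). iexp (t * y))"
      unfolding char_def M_def using distr_distr[OF X_meas assms(2)[OF n]] by (simp add: comp_def)
    also have "\<dots> = (CLINT B|uniform_count_measure (M2 n). iexp (t * X n B))"
      unfolding assms(3)[OF n] by (intro integral_distr) auto
    also have "\<dots> = (\<Sum>B\<in>M2 n. iexp (t * X n B)) / of_nat (card (M2 n))"
      by (simp add: uniform_count_measure_def lebesgue_integral_point_measure_finite finite_M2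
          sum_divide_distrib scaleR_conv_of_real)
    also have "(\<Sum>B\<in>M2 n. iexp (t * X n B))
        = (\<Sum>B\<in>M2 n. x t n ^ num_components n B) * exp (- \<i> * of_real (t * s n))"
      unfolding sum_distrib_right
    proof (rule sum.cong[OF refl])
      fix B
      have "t * X n B = real (num_components n B) * (t / s n) - t * s n"
        using sn by (simp add: X_def field_simps)
      then have "\<i> * of_real (t * X n B)
          = of_nat (num_components n B) * (\<i> * of_real (t / s n)) + - \<i> * of_real (t * s n)"
        by (simp only: of_real_diff of_real_mult[of "real (num_components n B)"] of_real_of_nat_eq)
          (simp only: diff_conv_add_uminus distrib_left mult_minus_left mult_minus_right mult.left_commute)
      then show "iexp (t * X n B) = x t n ^ num_components n B * exp (- \<i> * of_real (t * s n))"
        unfolding x_def exp_of_nat_mult[symmetric] exp_add[symmetric] by (simp only:)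
    qed
    also have "\<dots> / of_nat (card (M2 n)) = (\<Sum>B\<in>M2 n. x t n ^ num_components n B) / of_nat (card (M2 n))
        * exp (- \<i> * of_real (t * s n))"
      by simp
    also have "(\<Sum>B\<in>M2 n. x t n ^ num_components n B) / of_nat (card (M2 n))
        = fps_nth (comp_fps (1/2 + d t n)) n / fps_nth (comp_fps (1/2)) n"
      unfolding mean_M2_pow_num_components half ..
    finally show ?thesis .
  qed
  have char_lim: "(\<lambda>n. char (M n) t) \<longlonglongrightarrow> char std_normal_distribution t" for t
  proof -
    have "(\<lambda>n. t * inverse (s n)) \<longlonglongrightarrow> 0"
      by (rule tendsto_mult_right_zero[OF tendsto_inverse_0_at_top[OF s_top]])
    then have "(\<lambda>n. x t n) \<longlonglongrightarrow> exp (\<i> * of_real 0)"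
      unfolding x_def divide_inverse by (intro tendsto_intros)
    then have "(\<lambda>n. (x t n - 1) / 2) \<longlonglongrightarrow> (exp (\<i> * of_real 0) - 1) / 2"
      by (intro tendsto_intros) simp_all
    then have d: "d t \<longlonglongrightarrow> 0" unfolding d_def by simp
    have "(\<lambda>n. fps_nth (comp_fps (1/2 + d t n)) n / fps_nth (comp_fps (1/2)) n
        * exp (- d t n * of_real (ln (real n)))
        * exp (of_real (s n ^ 2) * (iexp (t / s n) - 1) - \<i> * of_real (t * s n)))
        \<longlonglongrightarrow> 1 * exp (of_real (- (t\<^sup>2) / 2))"
      by (rule tendsto_mult[OF comp_fps_quotient_tendsto[OF d]
            tendsto_exp[OF iexp_second_order_tendsto[OF s_top]]])
    moreover have "\<forall>\<^sub>F n in sequentially. fps_nth (comp_fps (1/2 + d t n)) n / fps_nth (comp_fps (1/2)) n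
        * exp (- d t n * of_real (ln (real n)))
        * exp (of_real (s n ^ 2) * (iexp (t / s n) - 1) - \<i> * of_real (t * s n)) = char (M n) t"
      using eventually_ge_at_top[of 2]
    proof eventually_elim
      case (elim n)
      have "of_real (ln (real n)) = (2 * of_real (s n ^ 2) :: complex)"
        using elim by (simp add: s_def)
      then have "- d t n * of_real (ln (real n))
          + (of_real (s n ^ 2) * (iexp (t / s n) - 1) - \<i> * of_real (t * s n)) = - \<i> * of_real (t * s n)"
        by (simp add: d_def x_def algebra_simps diff_divide_distrib)
      then show ?case
        unfolding char_M[OF elim] mult.assoc exp_add[symmetric] by (simp only:)
    qed
    ultimately have "(\<lambda>n. char (M n) t) \<longlonglongrightarrow> 1 * exp (of_real (- (t\<^sup>2) / 2))"
      by (rule Lim_transform_eventually)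
    then show ?thesis
      unfolding char_std_normal_distribution exp_of_real mult_1_left .
  qed
  \<comment> \<open>\<open>M 0\<close> and \<open>M 1\<close> need not be probability measures, so Levy's theorem is applied to the
    sequence shifted by \<open>2\<close>.\<close>
  have "weak_conv_m (\<lambda>n. M (n + 2)) std_normal_distribution"
  proof (rule levy_continuity)
    fix n
    interpret prob_space "\<Omega> (n + 2)" using assms(1) by simp
    have "(\<lambda>\<omega>. X (n + 2) (A (n + 2) \<omega>)) \<in> borel_measurable (\<Omega> (n + 2))"
      by (rule measurable_compose[OF assms(2) X_meas]) simp
    then show "real_distribution (M (n + 2))"
      unfolding M_def by (rule real_distribution_distr)
  next
    show "real_distribution std_normal_distribution" by (rule real_dist_normal_dist)
  next
    show "(\<lambda>n. char (M (n + 2)) t) \<longlonglongrightarrow> char std_normal_distribution t" for t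
      by (rule LIMSEQ_ignore_initial_segment[OF char_lim])
  qed
  then have "weak_conv_m M std_normal_distribution"
    unfolding weak_conv_m_def weak_conv_def by (auto intro: LIMSEQ_offset[of _ 2])
  then show ?thesis unfolding M_def X_def s_def .
qed

end
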